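(* Let $C$ be a category with finite products. The endofunctor $W_{gr}\colon s\mathbf{Grp}(C)\to s\mathbf{Grp}(C)$ defined in the context is a lift, up to isomorphism, of the universal bundle functor $W\colon s\mathbf{Grp}(C)\to sC$ through the forgetful functor $U\colon s\mathbf{Grp}(C)\to sC$; i.e. there is a natural isomorphism $W\cong U\circ W_{gr}$ of functors $s\mathbf{Grp}(C)\to sC$. Moreover, $W_{gr}$ is a monad (that is, it is the underlying endofunctor of a monad on $s\mathbf{Grp}(C)$).
   Context: $sC$ denotes the category of simplicial objects in $C$, and $s\mathbf{Grp}(C)$ the category of simplicial objects in the category $\mathbf{Grp}(C)$ of group objects in $C$ (simplicial groups in $C$). Formulas below are written with elements; in a general category $C$ with finite products they are interpreted using generalised elements. Juxtaposition is group multiplication, and $d_0 g\, h$ means $(d_0g)\cdot h$. Let $G$ be a simplicial group in $C$ with face maps $d_i$ and degeneracy maps $s_i$. The universal bundle $WG\in sC$ has $n$-simplices $(WG)_n=G_n\times\cdots\times G_0$, with face and degeneracy maps $$d_0(g_n,\ldots,g_0)=(d_0g_n\,g_{n-1},\,g_{n-2},\ldots,g_0),$$ $$d_i(g_n,\ldots,g_0)=(d_ig_n,\ldots,d_1g_{n-i+1},\,d_0g_{n-i}\,g_{n-i-1},\,g_{n-i-2},\ldots,g_0)\quad (0<i<n),$$ $$d_n(g_n,\ldots,g_0)=(d_ng_n,\ldots,d_1g_1)\quad (n\ge 1),$$ $$s_i(g_n,\ldots,g_0)=(s_ig_n,\ldots,s_0g_{n-i},\,1_{G_{n-i}},\,g_{n-i-1},\ldots,g_0),$$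 where $1_{G_{n-i}}$ is the identity element of $G_{n-i}$ (for $n=1$, $d_0(g_1,g_0)=(d_0g_1\,g_0)$). This is functorial in $G$, giving $W\colon s\mathbf{Grp}(C)\to sC$. The simplicial group $W_{gr}G$ has $n$-simplices $(W_{gr}G)_n=G_n\times\cdots\times G_0$ with componentwise group structure, and face and degeneracy maps $$d_0(g_n,\ldots,g_0)=(g_{n-1},g_{n-2},\ldots,g_0),$$ $$d_i(g_n,\ldots,g_0)=(d_ig_n,\ldots,d_1g_{n-i+1},\,g_{n-i-1},\ldots,g_0)\quad (i>0),$$ $$s_i(g_n,\ldots,g_0)=(s_ig_n,\ldots,s_0g_{n-i},\,g_{n-i},\,g_{n-i-1},\ldots,g_0)$$ (so $d_n(g_n,\ldots,g_0)=(d_ng_n,\ldots,d_1g_1)$ for $n\ge 1$). This is functorial in $G$, giving $W_{gr}\colon s\mathbf{Grp}(C)\to s\mathbf{Grp}(C)$. *)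

theory Defs
  imports Main
begin

section \<open>Categories, functors, natural transformations, monads\<close>

record ('o, 'm) cat =
  Obj :: "'o set"
  Arr :: "'m set"
  Dom :: "'m \<Rightarrow> 'o"
  Cod :: "'m \<Rightarrow> 'o"
  Idt :: "'o \<Rightarrow> 'm"
  Comp :: "'m \<Rightarrow> 'm \<Rightarrow> 'm" (infixl "\<cdot>\<index>" 70)

definition hom :: "('o, 'm, 'z) cat_scheme \<Rightarrow> 'o \<Rightarrow> 'o \<Rightarrow> 'm set" where
  "hom C x y = {f \<in> Arr C. Dom C f = x \<and> Cod C f = y}"

locale category =
  fixes C :: "('o, 'm, 'z) cat_scheme" (structure)
  assumes Dom_Obj: "f \<in> Arr C \<Longrightarrow> Dom C f \<in> Obj C"
    and Cod_Obj: "f \<in> Arr C \<Longrightarrow> Cod C f \<in> Obj C"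
    and Idt_hom: "x \<in> Obj C \<Longrightarrow> Idt C x \<in> hom C x x"
    and Comp_hom: "f \<in> hom C x y \<Longrightarrow> g \<in> hom C y z \<Longrightarrow> g \<cdot> f \<in> hom C x z"
    and Comp_Idt: "f \<in> hom C x y \<Longrightarrow> f \<cdot> Idt C x = f"
    and Idt_Comp: "f \<in> hom C x y \<Longrightarrow> Idt C y \<cdot> f = f"
    and Comp_assoc: "f \<in> hom C w x \<Longrightarrow> g \<in> hom C x y \<Longrightarrow> h \<in> hom C y z \<Longrightarrow>
      (h \<cdot> g) \<cdot> f = h \<cdot> (g \<cdot> f)"

definition iso_arrow :: "('o, 'm, 'z) cat_scheme \<Rightarrow> 'm \<Rightarrow> bool" where
  "iso_arrow C f \<longleftrightarrow> f \<in> Arr C \<and>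
    (\<exists>g \<in> hom C (Cod C f) (Dom C f).
       g \<cdot>\<^bsub>C\<^esub> f = Idt C (Dom C f) \<and> f \<cdot>\<^bsub>C\<^esub> g = Idt C (Cod C f))"

record ('o, 'm, 'p, 'n) ftr =
  fobj :: "'o \<Rightarrow> 'p"
  farr :: "'m \<Rightarrow> 'n"

definition ftr_id :: "('o, 'm, 'o, 'm) ftr" where
  "ftr_id = \<lparr>fobj = (\<lambda>x. x), farr = (\<lambda>f. f)\<rparr>"

definition ftr_comp ::
  "('p, 'n, 'q, 'k) ftr \<Rightarrow> ('o, 'm, 'p, 'n) ftr \<Rightarrow> ('o, 'm, 'q, 'k) ftr" where
  "ftr_comp G F = \<lparr>fobj = (\<lambda>x. fobj G (fobj F x)), farr = (\<lambda>f. farr G (farr F f))\<rparr>"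

locale cat_functor = C: category C + D: category D
  for C :: "('o, 'm, 'z) cat_scheme" and D :: "('p, 'n, 'y) cat_scheme" +
  fixes F :: "('o, 'm, 'p, 'n) ftr"
  assumes fobj_Obj: "x \<in> Obj C \<Longrightarrow> fobj F x \<in> Obj D"
    and farr_hom: "f \<in> hom C x y \<Longrightarrow> farr F f \<in> hom D (fobj F x) (fobj F y)"
    and farr_Idt: "x \<in> Obj C \<Longrightarrow> farr F (Idt C x) = Idt D (fobj F x)"
    and farr_Comp: "f \<in> hom C x y \<Longrightarrow> g \<in> hom C y z \<Longrightarrow>
      farr F (g \<cdot>\<^bsub>C\<^esub> f) = farr F g \<cdot>\<^bsub>D\<^esub> farr F f"

locale natural_transformation = F: cat_functor C D F + G: cat_functor C D G
  for C :: "('o, 'm, 'z) cat_scheme" and D :: "('p, 'n, 'y) cat_scheme"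
    and F G :: "('o, 'm, 'p, 'n) ftr" +
  fixes t :: "'o \<Rightarrow> 'n"
  assumes component_hom: "x \<in> Obj C \<Longrightarrow> t x \<in> hom D (fobj F x) (fobj G x)"
    and naturality: "f \<in> hom C x y \<Longrightarrow> t y \<cdot>\<^bsub>D\<^esub> farr F f = farr G f \<cdot>\<^bsub>D\<^esub> t x"

locale natural_isomorphism = natural_transformation +
  assumes component_iso: "x \<in> Obj C \<Longrightarrow> iso_arrow D (t x)"

definition naturally_isomorphic ::
  "('o, 'm, 'z) cat_scheme \<Rightarrow> ('p, 'n, 'y) cat_scheme \<Rightarrow>
   ('o, 'm, 'p, 'n) ftr \<Rightarrow> ('o, 'm, 'p, 'n) ftr \<Rightarrow> bool" where
  "naturally_isomorphic C D F G \<longleftrightarrow> (\<exists>t. natural_isomorphism C D F G t)"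

locale cat_monad =
  T: cat_functor C C T +
  unit: natural_transformation C C ftr_id T \<eta> +
  mult: natural_transformation C C "ftr_comp T T" T \<mu>
  for C :: "('o, 'm, 'z) cat_scheme" and T :: "('o, 'm, 'o, 'm) ftr"
    and \<eta> \<mu> :: "'o \<Rightarrow> 'm" +
  assumes monad_assoc: "x \<in> Obj C \<Longrightarrow>
      \<mu> x \<cdot>\<^bsub>C\<^esub> farr T (\<mu> x) = \<mu> x \<cdot>\<^bsub>C\<^esub> \<mu> (fobj T x)"
    and monad_unit_left: "x \<in> Obj C \<Longrightarrow> \<mu> x \<cdot>\<^bsub>C\<^esub> \<eta> (fobj T x) = Idt C (fobj T x)"
    and monad_unit_right: "x \<in> Obj C \<Longrightarrow> \<mu> x \<cdot>\<^bsub>C\<^esub> farr T (\<eta> x) = Idt C (fobj T x)"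


section \<open>Finite products\<close>

definition is_product ::
  "('o, 'm, 'z) cat_scheme \<Rightarrow> 'o list \<Rightarrow> 'o \<Rightarrow> (nat \<Rightarrow> 'm) \<Rightarrow> bool" where
  "is_product C as p \<pi> \<longleftrightarrow>
    p \<in> Obj C \<and> (\<forall>k < length as. \<pi> k \<in> hom C p (as ! k)) \<and>
    (\<forall>x \<in> Obj C. \<forall>fs.
       length fs = length as \<longrightarrow> (\<forall>k < length as. fs ! k \<in> hom C x (as ! k)) \<longrightarrow>
       (\<exists>!h. h \<in> hom C x p \<and> (\<forall>k < length as. \<pi> k \<cdot>\<^bsub>C\<^esub> h = fs ! k)))"

text \<open>
  A category with finite products comes with an arbitrary choice of a product for every
  finite list of objects; nothing is assumed about the choice (so, for instance, the unary
  product \<open>Prod C [a]\<close> is isomorphic, but possibly not equal, to \<open>a\<close>).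
  \<open>Prod C []\<close> is a terminal object.
\<close>

record ('o, 'm) fp_cat = "('o, 'm) cat" +
  Prod :: "'o list \<Rightarrow> 'o"
  Proj :: "'o list \<Rightarrow> nat \<Rightarrow> 'm"

locale finite_product_category = category C
  for C :: "('o, 'm, 'z) fp_cat_scheme" (structure) +
  assumes product: "set as \<subseteq> Obj C \<Longrightarrow> is_product C as (Prod C as) (Proj C as)"

text \<open>\<open>tuple C x [f\<^sub>0, \<dots>, f\<^sub>r]\<close> is the arrow from \<open>x\<close> to the product of the
  codomains of the \<open>f\<^sub>k\<close>; the source \<open>x\<close> is needed for the empty tuple.\<close>

definition tuple :: "('o, 'm, 'z) fp_cat_scheme \<Rightarrow> 'o \<Rightarrow> 'm list \<Rightarrow> 'm" where
  "tuple C x fs =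
    (THE h. h \<in> hom C x (Prod C (map (Cod C) fs)) \<and>
       (\<forall>k < length fs. Proj C (map (Cod C) fs) k \<cdot>\<^bsub>C\<^esub> h = fs ! k))"


section \<open>Arrows of categories of structured objects\<close>

text \<open>A homomorphism remembers its source and target; \<open>hmap\<close> is its underlying datum.\<close>

datatype ('x, 'f) harr = HArr (hsrc: 'x) (htgt: 'x) (hmap: 'f)


section \<open>Group objects\<close>

datatype ('o, 'm) grp_obj = GrpObj (gcar: 'o) (gmult: 'm) (gunit: 'm) (ginv: 'm)

text \<open>Product of two generalised elements \<open>a, b : x \<rightarrow> G\<close>, and the identity element
  of \<open>G\<close> at stage \<open>x\<close>.\<close>

definition gmul :: "('o, 'm, 'z) fp_cat_scheme \<Rightarrow> ('o, 'm) grp_obj \<Rightarrow> 'm \<Rightarrow> 'm \<Rightarrow> 'm" where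
  "gmul C G a b = gmult G \<cdot>\<^bsub>C\<^esub> tuple C (Dom C a) [a, b]"

definition gone :: "('o, 'm, 'z) fp_cat_scheme \<Rightarrow> ('o, 'm) grp_obj \<Rightarrow> 'o \<Rightarrow> 'm" where
  "gone C G x = gunit G \<cdot>\<^bsub>C\<^esub> tuple C x []"

definition group_object :: "('o, 'm, 'z) fp_cat_scheme \<Rightarrow> ('o, 'm) grp_obj \<Rightarrow> bool" where
  "group_object C G \<longleftrightarrow>
    (let c = gcar G; e = Idt C c; p = Proj C [c, c, c] in
      c \<in> Obj C \<and>
      gmult G \<in> hom C (Prod C [c, c]) c \<and>
      gunit G \<in> hom C (Prod C []) c \<and>
      ginv G \<in> hom C c c \<and>
      gmul C G (gmul C G (p 0) (p 1)) (p 2) = gmul C G (p 0) (gmul C G (p 1) (p 2)) \<and>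
      gmul C G (gone C G c) e = e \<and>
      gmul C G e (gone C G c) = e \<and>
      gmul C G (ginv G) e = gone C G c \<and>
      gmul C G e (ginv G) = gone C G c)"

definition group_hom ::
  "('o, 'm, 'z) fp_cat_scheme \<Rightarrow> ('o, 'm) grp_obj \<Rightarrow> ('o, 'm) grp_obj \<Rightarrow> 'm \<Rightarrow> bool" where
  "group_hom C G H f \<longleftrightarrow>
    f \<in> hom C (gcar G) (gcar H) \<and>
    (let p = Proj C [gcar G, gcar G] in
      f \<cdot>\<^bsub>C\<^esub> gmult G = gmul C H (f \<cdot>\<^bsub>C\<^esub> p 0) (f \<cdot>\<^bsub>C\<^esub> p 1))"

definition Grp ::
  "('o, 'm, 'z) fp_cat_scheme \<Rightarrow> (('o, 'm) grp_obj, (('o, 'm) grp_obj, 'm) harr) cat" where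
  "Grp C =
    \<lparr>Obj = {G. group_object C G},
     Arr = {F. group_object C (hsrc F) \<and> group_object C (htgt F) \<and>
               group_hom C (hsrc F) (htgt F) (hmap F)},
     Dom = hsrc,
     Cod = htgt,
     Idt = (\<lambda>G. HArr G G (Idt C (gcar G))),
     Comp = (\<lambda>F' F. HArr (hsrc F) (htgt F') (hmap F' \<cdot>\<^bsub>C\<^esub> hmap F))\<rparr>"

definition forget_Grp ::
  "(('o, 'm) grp_obj, (('o, 'm) grp_obj, 'm) harr, 'o, 'm) ftr" where
  "forget_Grp = \<lparr>fobj = gcar, farr = hmap\<rparr>"


section \<open>Simplicial objects\<close>

text \<open>
  \<open>face X n i\<close> is \<open>d\<^sub>i : X\<^sub>n \<rightarrow> X\<^sub>n\<^sub>-\<^sub>1\<close> (for \<open>0 < n\<close>, \<open>i \<le> n\<close>) and \<open>degen X n i\<close> is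
  \<open>s\<^sub>i : X\<^sub>n \<rightarrow> X\<^sub>n\<^sub>+\<^sub>1\<close> (for \<open>i \<le> n\<close>).  Outside these ranges both are required to be
  \<open>undefined\<close>, so that equality of simplicial objects is the expected one.
\<close>

datatype ('o, 'm) sobj =
  SObj (splx: "nat \<Rightarrow> 'o") (face: "nat \<Rightarrow> nat \<Rightarrow> 'm") (degen: "nat \<Rightarrow> nat \<Rightarrow> 'm")

definition mk_sobj ::
  "(nat \<Rightarrow> 'o) \<Rightarrow> (nat \<Rightarrow> nat \<Rightarrow> 'm) \<Rightarrow> (nat \<Rightarrow> nat \<Rightarrow> 'm) \<Rightarrow> ('o, 'm) sobj" where
  "mk_sobj X d s = SObj X
    (\<lambda>n i. if 0 < n \<and> i \<le> n then d n i else undefined)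
    (\<lambda>n i. if i \<le> n then s n i else undefined)"

definition simplicial_object :: "('o, 'm, 'z) cat_scheme \<Rightarrow> ('o, 'm) sobj \<Rightarrow> bool" where
  "simplicial_object C X \<longleftrightarrow>
    (let d = face X; s = degen X in
      (\<forall>n. splx X n \<in> Obj C) \<and>
      (\<forall>n i. 0 < n \<and> i \<le> n \<longrightarrow> d n i \<in> hom C (splx X n) (splx X (n - 1))) \<and>
      (\<forall>n i. i \<le> n \<longrightarrow> s n i \<in> hom C (splx X n) (splx X (n + 1))) \<and>
      (\<forall>n i j. 2 \<le> n \<and> i < j \<and> j \<le> n \<longrightarrow>
         d (n - 1) i \<cdot>\<^bsub>C\<^esub> d n j = d (n - 1) (j - 1) \<cdot>\<^bsub>C\<^esub> d n i) \<and>
      (\<forall>n i j. i \<le> j \<and> j \<le> n \<longrightarrow>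
         s (n + 1) i \<cdot>\<^bsub>C\<^esub> s n j = s (n + 1) (j + 1) \<cdot>\<^bsub>C\<^esub> s n i) \<and>
      (\<forall>n i j. i < j \<and> j \<le> n \<longrightarrow>
         d (n + 1) i \<cdot>\<^bsub>C\<^esub> s n j = s (n - 1) (j - 1) \<cdot>\<^bsub>C\<^esub> d n i) \<and>
      (\<forall>n i j. j \<le> n \<and> (i = j \<or> i = j + 1) \<longrightarrow>
         d (n + 1) i \<cdot>\<^bsub>C\<^esub> s n j = Idt C (splx X n)) \<and>
      (\<forall>n i j. j + 1 < i \<and> i \<le> n + 1 \<longrightarrow>
         d (n + 1) i \<cdot>\<^bsub>C\<^esub> s n j = s (n - 1) j \<cdot>\<^bsub>C\<^esub> d n (i - 1)) \<and>
      (\<forall>n i. \<not> (0 < n \<and> i \<le> n) \<longrightarrow> d n i = undefined) \<and>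
      (\<forall>n i. \<not> i \<le> n \<longrightarrow> s n i = undefined))"

definition simplicial_map ::
  "('o, 'm, 'z) cat_scheme \<Rightarrow> ('o, 'm) sobj \<Rightarrow> ('o, 'm) sobj \<Rightarrow> (nat \<Rightarrow> 'm) \<Rightarrow> bool" where
  "simplicial_map C X Y f \<longleftrightarrow>
    (\<forall>n. f n \<in> hom C (splx X n) (splx Y n)) \<and>
    (\<forall>n i. 0 < n \<and> i \<le> n \<longrightarrow> f (n - 1) \<cdot>\<^bsub>C\<^esub> face X n i = face Y n i \<cdot>\<^bsub>C\<^esub> f n) \<and>
    (\<forall>n i. i \<le> n \<longrightarrow> f (n + 1) \<cdot>\<^bsub>C\<^esub> degen X n i = degen Y n i \<cdot>\<^bsub>C\<^esub> f n)"

definition Simp ::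
  "('o, 'm, 'z) cat_scheme \<Rightarrow> (('o, 'm) sobj, (('o, 'm) sobj, nat \<Rightarrow> 'm) harr) cat" where
  "Simp C =
    \<lparr>Obj = {X. simplicial_object C X},
     Arr = {F. simplicial_object C (hsrc F) \<and> simplicial_object C (htgt F) \<and>
               simplicial_map C (hsrc F) (htgt F) (hmap F)},
     Dom = hsrc,
     Cod = htgt,
     Idt = (\<lambda>X. HArr X X (\<lambda>n. Idt C (splx X n))),
     Comp = (\<lambda>F' F. HArr (hsrc F) (htgt F') (\<lambda>n. hmap F' n \<cdot>\<^bsub>C\<^esub> hmap F n))\<rparr>"

definition simp_ftr_obj :: "('o, 'm, 'p, 'n) ftr \<Rightarrow> ('o, 'm) sobj \<Rightarrow> ('p, 'n) sobj" where
  "simp_ftr_obj F X = mk_sobj (\<lambda>n. fobj F (splx X n))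
     (\<lambda>n i. farr F (face X n i)) (\<lambda>n i. farr F (degen X n i))"

definition simp_ftr ::
  "('o, 'm, 'p, 'n) ftr \<Rightarrow>
   (('o, 'm) sobj, (('o, 'm) sobj, nat \<Rightarrow> 'm) harr,
    ('p, 'n) sobj, (('p, 'n) sobj, nat \<Rightarrow> 'n) harr) ftr" where
  "simp_ftr F =
    \<lparr>fobj = simp_ftr_obj F,
     farr = (\<lambda>f. HArr (simp_ftr_obj F (hsrc f)) (simp_ftr_obj F (htgt f))
                   (\<lambda>n. farr F (hmap f n)))\<rparr>"

type_synonym ('o, 'm) sgrp = "(('o, 'm) grp_obj, (('o, 'm) grp_obj, 'm) harr) sobj"
type_synonym ('o, 'm) sgrp_arr =
  "(('o, 'm) sgrp, nat \<Rightarrow> (('o, 'm) grp_obj, 'm) harr) harr"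
type_synonym ('o, 'm) sobj_arr = "(('o, 'm) sobj, nat \<Rightarrow> 'm) harr"

abbreviation sGrp ::
  "('o, 'm, 'z) fp_cat_scheme \<Rightarrow> (('o, 'm) sgrp, ('o, 'm) sgrp_arr) cat" where
  "sGrp C \<equiv> Simp (Grp C)"

definition forget_sGrp ::
  "(('o, 'm) sgrp, ('o, 'm) sgrp_arr, ('o, 'm) sobj, ('o, 'm) sobj_arr) ftr" where
  "forget_sGrp = simp_ftr forget_Grp"


section \<open>The functors \<open>W\<close> and \<open>W\<^sub>g\<^sub>r\<close>\<close>

text \<open>
  \<open>W_space C G n\<close> is the product \<open>G\<^sub>n \<times> \<dots> \<times> G\<^sub>0\<close>, and \<open>W_el C G n k\<close> is its projection
  to \<open>G\<^sub>k\<close>, that is, the entry \<open>g\<^sub>k\<close> of the universal generalised element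
  \<open>(g\<^sub>n, \<dots>, g\<^sub>0)\<close>.  An arrow out of \<open>W_space C G n\<close> given by a formula in
  \<open>(g\<^sub>n, \<dots>, g\<^sub>0)\<close> is obtained by evaluating the formula at this element.
\<close>

definition W_objs :: "('o, 'm) sgrp \<Rightarrow> nat \<Rightarrow> 'o list" where
  "W_objs G n = map (\<lambda>k. gcar (splx G k)) (rev [0..<Suc n])"

definition W_space :: "('o, 'm, 'z) fp_cat_scheme \<Rightarrow> ('o, 'm) sgrp \<Rightarrow> nat \<Rightarrow> 'o" where
  "W_space C G n = Prod C (W_objs G n)"

definition W_el :: "('o, 'm, 'z) fp_cat_scheme \<Rightarrow> ('o, 'm) sgrp \<Rightarrow> nat \<Rightarrow> nat \<Rightarrow> 'm" where
  "W_el C G n k = Proj C (W_objs G n) (n - k)"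

definition W_face ::
  "('o, 'm, 'z) fp_cat_scheme \<Rightarrow> ('o, 'm) sgrp \<Rightarrow> nat \<Rightarrow> nat \<Rightarrow> 'm" where
  "W_face C G n i =
    (let g = W_el C G n; d = (\<lambda>k j. hmap (face G k j)) in
      tuple C (W_space C G n)
       (map (\<lambda>j. d (n - j) (i - j) \<cdot>\<^bsub>C\<^esub> g (n - j)) [0..<i] @
        (if i < n
         then [gmul C (splx G (n - i - 1)) (d (n - i) 0 \<cdot>\<^bsub>C\<^esub> g (n - i)) (g (n - i - 1))]
         else []) @
        map g (rev [0..<n - i - 1])))"

definition W_degen ::
  "('o, 'm, 'z) fp_cat_scheme \<Rightarrow> ('o, 'm) sgrp \<Rightarrow> nat \<Rightarrow> nat \<Rightarrow> 'm" where
  "W_degen C G n i =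
    (let g = W_el C G n; s = (\<lambda>k j. hmap (degen G k j)) in
      tuple C (W_space C G n)
       (map (\<lambda>j. s (n - j) (i - j) \<cdot>\<^bsub>C\<^esub> g (n - j)) [0..<Suc i] @
        [gone C (splx G (n - i)) (W_space C G n)] @
        map g (rev [0..<n - i])))"

definition W_map ::
  "('o, 'm, 'z) fp_cat_scheme \<Rightarrow> ('o, 'm) sgrp_arr \<Rightarrow> nat \<Rightarrow> 'm" where
  "W_map C F n = tuple C (W_space C (hsrc F) n)
    (map (\<lambda>k. hmap (hmap F k) \<cdot>\<^bsub>C\<^esub> W_el C (hsrc F) n k) (rev [0..<Suc n]))"

definition W_obj :: "('o, 'm, 'z) fp_cat_scheme \<Rightarrow> ('o, 'm) sgrp \<Rightarrow> ('o, 'm) sobj" where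
  "W_obj C G = mk_sobj (W_space C G) (W_face C G) (W_degen C G)"

definition W_functor ::
  "('o, 'm, 'z) fp_cat_scheme \<Rightarrow>
   (('o, 'm) sgrp, ('o, 'm) sgrp_arr, ('o, 'm) sobj, ('o, 'm) sobj_arr) ftr" where
  "W_functor C =
    \<lparr>fobj = W_obj C,
     farr = (\<lambda>F. HArr (W_obj C (hsrc F)) (W_obj C (htgt F)) (W_map C F))\<rparr>"

definition Wgr_group ::
  "('o, 'm, 'z) fp_cat_scheme \<Rightarrow> ('o, 'm) sgrp \<Rightarrow> nat \<Rightarrow> ('o, 'm) grp_obj" where
  "Wgr_group C G n =
    (let w = W_space C G n; g = W_el C G n; p = Proj C [w, w]; ks = rev [0..<Suc n] in
      GrpObj w
        (tuple C (Prod C [w, w])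
          (map (\<lambda>k. gmul C (splx G k) (g k \<cdot>\<^bsub>C\<^esub> p 0) (g k \<cdot>\<^bsub>C\<^esub> p 1)) ks))
        (tuple C (Prod C []) (map (\<lambda>k. gunit (splx G k)) ks))
        (tuple C w (map (\<lambda>k. ginv (splx G k) \<cdot>\<^bsub>C\<^esub> g k) ks)))"

definition Wgr_face ::
  "('o, 'm, 'z) fp_cat_scheme \<Rightarrow> ('o, 'm) sgrp \<Rightarrow> nat \<Rightarrow> nat \<Rightarrow> 'm" where
  "Wgr_face C G n i =
    (let g = W_el C G n; d = (\<lambda>k j. hmap (face G k j)) in
      tuple C (W_space C G n)
       (map (\<lambda>j. d (n - j) (i - j) \<cdot>\<^bsub>C\<^esub> g (n - j)) [0..<i] @
        map g (rev [0..<n - i])))"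

definition Wgr_degen ::
  "('o, 'm, 'z) fp_cat_scheme \<Rightarrow> ('o, 'm) sgrp \<Rightarrow> nat \<Rightarrow> nat \<Rightarrow> 'm" where
  "Wgr_degen C G n i =
    (let g = W_el C G n; s = (\<lambda>k j. hmap (degen G k j)) in
      tuple C (W_space C G n)
       (map (\<lambda>j. s (n - j) (i - j) \<cdot>\<^bsub>C\<^esub> g (n - j)) [0..<Suc i] @
        map g (rev [0..<Suc (n - i)])))"

definition Wgr_obj :: "('o, 'm, 'z) fp_cat_scheme \<Rightarrow> ('o, 'm) sgrp \<Rightarrow> ('o, 'm) sgrp" where
  "Wgr_obj C G = mk_sobj (Wgr_group C G)
    (\<lambda>n i. HArr (Wgr_group C G n) (Wgr_group C G (n - 1)) (Wgr_face C G n i))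
    (\<lambda>n i. HArr (Wgr_group C G n) (Wgr_group C G (n + 1)) (Wgr_degen C G n i))"

definition Wgr_functor ::
  "('o, 'm, 'z) fp_cat_scheme \<Rightarrow>
   (('o, 'm) sgrp, ('o, 'm) sgrp_arr, ('o, 'm) sgrp, ('o, 'm) sgrp_arr) ftr" where
  "Wgr_functor C =
    \<lparr>fobj = Wgr_obj C,
     farr = (\<lambda>F. HArr (Wgr_obj C (hsrc F)) (Wgr_obj C (htgt F))
        (\<lambda>n. HArr (Wgr_group C (hsrc F) n) (Wgr_group C (htgt F) n) (W_map C F n)))\<rparr>"

end

theory Submission
  imports Defs
begin

text \<open>
  The isomorphism \<open>\<theta> : W G \<rightarrow> Wgr G\<close> sends \<open>(g\<^sub>n, \<dots>, g\<^sub>0)\<close> to \<open>(h\<^sub>n, \<dots>, h\<^sub>0)\<close>, where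
  \<open>h\<^sub>n = g\<^sub>n\<close> and \<open>h\<^sub>k = (d\<^sub>0 h\<^sub>k\<^sub>+\<^sub>1) g\<^sub>k\<close>; its inverse is \<open>g\<^sub>k = (d\<^sub>0 h\<^sub>k\<^sub>+\<^sub>1)\<inverse> h\<^sub>k\<close>.
  The entry \<open>g\<^sub>k\<close> of an \<open>n\<close>-simplex of \<open>Wgr G\<close> is to be thought of as a simplex on the last
  \<open>k + 1\<close> vertices of \<open>{0, \<dots>, n}\<close>.  The unit of the monad restricts a simplex to all final
  segments, \<open>g \<mapsto> (g, d\<^sub>0 g, d\<^sub>0 d\<^sub>0 g, \<dots>)\<close>, and the multiplication takes the diagonal of a simplex
  of \<open>Wgr (Wgr G)\<close>: it replaces each entry \<open>w\<^sub>k \<in> (Wgr G)\<^sub>k\<close> by the leading entry of \<open>w\<^sub>k\<close>.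
\<close>

section \<open>Categories and simplicial objects\<close>

text \<open>Unwinding the recursion gives h_k = (d_0^(n-k) g_n) ... (d_0 g_(k+1)) g_k. The product
  (d_0 g_(k+1)) g_k that a face of W forms is thus already contained in h_k, and after \<theta> the
  face merely omits an entry. In the same way the identity element inserted by a degeneracy of W
  turns into a repetition of h_k, because d_0 s_0 is the identity. An arrow is recognised as
  \<theta> h from its top entry and from the relation between its entries k and k + 1, which keeps
  the comparison with faces and degeneracies local. The same device serves for the unit, which is g
  |-> \<theta>(g, 1, ..., 1). Neither the simplicial identities of W nor the naturality of its
  structure maps are computed with products: \<theta> is invertible in each degree, so both are
  pulled back from Wgr, where they hold entry by entry. Formulas in elements are read as equations
  between arrows out of an arbitrary stage; each rule about a structure map therefore needs a form
  with a further arrow composed on the right.\<close>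

lemma homD:
  assumes "f \<in> hom C x y"
  shows "f \<in> Arr C" "Dom C f = x" "Cod C f = y"
  using assms by (auto simp: hom_def)

context category
begin

text \<open>Composability is stated by equations between \<open>Dom\<close> and \<open>Cod\<close>
  rather than by membership in \<open>hom\<close>, whose middle object a rewrite rule would have to
  guess. Typing is thus settled by simplification.\<close>

lemma comp_arr [simp]:
  assumes "f \<in> Arr C" "g \<in> Arr C" "Dom C g = Cod C f"
  shows "g \<cdot> f \<in> Arr C" "Dom C (g \<cdot> f) = Dom C f" "Cod C (g \<cdot> f) = Cod C g"
  using Comp_hom[of f "Dom C f" "Cod C f" g "Cod C g"] assms by (auto simp: hom_def)

text \<open>Composites are normalised to the right. A rule that rewrites \<open>f \<cdot> g\<close>
  then no longer matches inside \<open>f \<cdot> (g \<cdot> h)\<close>, which is the reason for the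
  many variants below with a trailing arrow.\<close>

lemma comp_assoc [simp]:
  assumes "f \<in> Arr C" "g \<in> Arr C" "h \<in> Arr C" "Dom C g = Cod C f" "Dom C h = Cod C g"
  shows "(h \<cdot> g) \<cdot> f = h \<cdot> (g \<cdot> f)"
  using Comp_assoc[of f "Dom C f" "Cod C f" g "Cod C g" h "Cod C h"] assms
  by (auto simp: hom_def)

lemma idt_arr [simp]:
  assumes "x \<in> Obj C"
  shows "Idt C x \<in> Arr C" "Dom C (Idt C x) = x" "Cod C (Idt C x) = x"
  using Idt_hom[OF assms] by (auto simp: hom_def)

lemma comp_idt [simp]: "f \<in> Arr C \<Longrightarrow> Dom C f = x \<Longrightarrow> f \<cdot> Idt C x = f"
  using Comp_Idt[of f x "Cod C f"] by (auto simp: hom_def)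

lemma idt_comp [simp]: "f \<in> Arr C \<Longrightarrow> Cod C f = y \<Longrightarrow> Idt C y \<cdot> f = f"
  using Idt_Comp[of f "Dom C f" y] by (auto simp: hom_def)

lemma dom_cod_obj [simp]: "f \<in> Arr C \<Longrightarrow> Dom C f \<in> Obj C" "f \<in> Arr C \<Longrightarrow> Cod C f \<in> Obj C"
  by (rule Dom_Obj Cod_Obj, assumption)+

end

lemma mk_sobj_sel [simp]:
  "splx (mk_sobj X d s) = X"
  "i \<le> Suc n \<Longrightarrow> face (mk_sobj X d s) (Suc n) i = d (Suc n) i"
  "i \<le> n \<Longrightarrow> degen (mk_sobj X d s) n i = s n i"
  by (auto simp: mk_sobj_def)

text \<open>With all degrees written as successors, truncated subtraction disappears:
  \<open>i < j\<close> in the definition becomes \<open>i \<le> j\<close> with \<open>Suc j\<close>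
  as the index. The clauses about indices out of range hold because \<open>mk_sobj\<close> puts
  \<open>undefined\<close> there.\<close>

lemma simplicial_object_mk_sobjI:
  fixes C :: "('o, 'm, 'z) cat_scheme" (structure)
  assumes "\<And>n. X n \<in> Obj C"
    and d: "\<And>n i. i \<le> Suc n \<Longrightarrow> d (Suc n) i \<in> hom C (X (Suc n)) (X n)"
    and s: "\<And>n i. i \<le> n \<Longrightarrow> s n i \<in> hom C (X n) (X (Suc n))"
    and dd: "\<And>n i j. i \<le> j \<Longrightarrow> j \<le> Suc n \<Longrightarrow>
      d (Suc n) i \<cdot> d (Suc (Suc n)) (Suc j) = d (Suc n) j \<cdot> d (Suc (Suc n)) i"
    and ss: "\<And>n i j. i \<le> j \<Longrightarrow> j \<le> n \<Longrightarrow> s (Suc n) i \<cdot> s n j = s (Suc n) (Suc j) \<cdot> s n i"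
    and ds_less: "\<And>n i j. i \<le> j \<Longrightarrow> j \<le> n \<Longrightarrow>
      d (Suc (Suc n)) i \<cdot> s (Suc n) (Suc j) = s n j \<cdot> d (Suc n) i"
    and ds_eq: "\<And>n j. j \<le> n \<Longrightarrow> d (Suc n) j \<cdot> s n j = Idt C (X n)"
    and ds_Suc: "\<And>n j. j \<le> n \<Longrightarrow> d (Suc n) (Suc j) \<cdot> s n j = Idt C (X n)"
    and ds_greater: "\<And>n i j. j < i \<Longrightarrow> i \<le> Suc n \<Longrightarrow>
      d (Suc (Suc n)) (Suc i) \<cdot> s (Suc n) j = s n j \<cdot> d (Suc n) i"
  shows "simplicial_object C (mk_sobj X d s)"
proof -
  have A1: "d n i \<in> hom C (X n) (X (n - 1))" if "0 < n" "i \<le> n" for n i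
    using that d[of i "n - 1"] by simp
  have A2: "d (n - 1) i \<cdot> d n j = d (n - 1) (j - 1) \<cdot> d n i"
    if c: "2 \<le> n" "i < j" "j \<le> n" for n i j
  proof -
    obtain m j' where "n = Suc (Suc m)" "j = Suc j'"
      using c by (cases n; cases "n - 1"; cases j) auto
    then show ?thesis using c dd[of i j' m] by simp
  qed
  have A3: "d (Suc n) i \<cdot> s n j = s (n - 1) (j - 1) \<cdot> d n i"
    if c: "i < j" "j \<le> n" for n i j
  proof -
    obtain m j' where "n = Suc m" "j = Suc j'"
      using c by (cases n; cases j) auto
    then show ?thesis using c ds_less[of i j' m] by simp
  qed
  have A4: "d (Suc n) i \<cdot> s n j = s (n - 1) j \<cdot> d n (i - 1)"
    if c: "Suc j < i" "i \<le> Suc n" for n i j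
  proof -
    obtain m i' where "n = Suc m" "i = Suc i'"
      using c by (cases n; cases i) auto
    then show ?thesis using c ds_greater[of j i' m] by simp
  qed
  show ?thesis
    unfolding simplicial_object_def mk_sobj_def Let_def sobj.sel
    by (intro conjI allI impI; (elim conjE disjE)?)
      (auto simp: assms(1) A1[simplified] A2[simplified] A3[simplified] A4[simplified]
        s ss ds_eq ds_Suc)
qed

lemma simplicial_objectD:
  fixes C :: "('o, 'm, 'z) cat_scheme" (structure)
  assumes "simplicial_object C X"
  shows "splx X n \<in> Obj C"
    and "i \<le> Suc n \<Longrightarrow> face X (Suc n) i \<in> hom C (splx X (Suc n)) (splx X n)"
    and "i \<le> n \<Longrightarrow> degen X n i \<in> hom C (splx X n) (splx X (Suc n))"
    and "i \<le> j \<Longrightarrow> j \<le> Suc n \<Longrightarrow>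
      face X (Suc n) i \<cdot> face X (Suc (Suc n)) (Suc j) = face X (Suc n) j \<cdot> face X (Suc (Suc n)) i"
    and "i \<le> j \<Longrightarrow> j \<le> n \<Longrightarrow>
      degen X (Suc n) i \<cdot> degen X n j = degen X (Suc n) (Suc j) \<cdot> degen X n i"
    and "i \<le> j \<Longrightarrow> j \<le> n \<Longrightarrow>
      face X (Suc (Suc n)) i \<cdot> degen X (Suc n) (Suc j) = degen X n j \<cdot> face X (Suc n) i"
    and "j \<le> n \<Longrightarrow> face X (Suc n) j \<cdot> degen X n j = Idt C (splx X n)"
    and "j \<le> n \<Longrightarrow> face X (Suc n) (Suc j) \<cdot> degen X n j = Idt C (splx X n)"
    and "j < i \<Longrightarrow> i \<le> Suc n \<Longrightarrow>
      face X (Suc (Suc n)) (Suc i) \<cdot> degen X (Suc n) j = degen X n j \<cdot> face X (Suc n) i"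
proof -
  have dd: "\<forall>n i j. 2 \<le> n \<and> i < j \<and> j \<le> n \<longrightarrow>
       face X (n - 1) i \<cdot> face X n j = face X (n - 1) (j - 1) \<cdot> face X n i"
    and ss: "\<forall>n i j. i \<le> j \<and> j \<le> n \<longrightarrow>
       degen X (n + 1) i \<cdot> degen X n j = degen X (n + 1) (j + 1) \<cdot> degen X n i"
    and ds_less: "\<forall>n i j. i < j \<and> j \<le> n \<longrightarrow>
       face X (n + 1) i \<cdot> degen X n j = degen X (n - 1) (j - 1) \<cdot> face X n i"
    and ds_eq: "\<forall>n i j. j \<le> n \<and> (i = j \<or> i = j + 1) \<longrightarrow>
       face X (n + 1) i \<cdot> degen X n j = Idt C (splx X n)"
    and ds_greater: "\<forall>n i j. j + 1 < i \<and> i \<le> n + 1 \<longrightarrow>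
       face X (n + 1) i \<cdot> degen X n j = degen X (n - 1) j \<cdot> face X n (i - 1)"
    and d: "\<forall>n i. 0 < n \<and> i \<le> n \<longrightarrow> face X n i \<in> hom C (splx X n) (splx X (n - 1))"
    and s: "\<forall>n i. i \<le> n \<longrightarrow> degen X n i \<in> hom C (splx X n) (splx X (n + 1))"
    and o: "\<forall>n. splx X n \<in> Obj C"
    using assms unfolding simplicial_object_def Let_def by - (elim conjE, assumption)+
  show "splx X n \<in> Obj C" using o by simp
  show "i \<le> Suc n \<Longrightarrow> face X (Suc n) i \<in> hom C (splx X (Suc n)) (splx X n)"
    using d[rule_format, of "Suc n" i] by simp
  show "i \<le> n \<Longrightarrow> degen X n i \<in> hom C (splx X n) (splx X (Suc n))"
    using s[rule_format, of i n] by simp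
  show "i \<le> j \<Longrightarrow> j \<le> Suc n \<Longrightarrow>
      face X (Suc n) i \<cdot> face X (Suc (Suc n)) (Suc j) = face X (Suc n) j \<cdot> face X (Suc (Suc n)) i"
    using dd[rule_format, of "Suc (Suc n)" i "Suc j"] by simp
  show "i \<le> j \<Longrightarrow> j \<le> n \<Longrightarrow>
      degen X (Suc n) i \<cdot> degen X n j = degen X (Suc n) (Suc j) \<cdot> degen X n i"
    using ss[rule_format, of i j n] by simp
  show "i \<le> j \<Longrightarrow> j \<le> n \<Longrightarrow>
      face X (Suc (Suc n)) i \<cdot> degen X (Suc n) (Suc j) = degen X n j \<cdot> face X (Suc n) i"
    using ds_less[rule_format, of i "Suc j" "Suc n"] by simp
  show "j \<le> n \<Longrightarrow> face X (Suc n) j \<cdot> degen X n j = Idt C (splx X n)"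
    using ds_eq[rule_format, of j n j] by simp
  show "j \<le> n \<Longrightarrow> face X (Suc n) (Suc j) \<cdot> degen X n j = Idt C (splx X n)"
    using ds_eq[rule_format, of j n "Suc j"] by simp
  show "j < i \<Longrightarrow> i \<le> Suc n \<Longrightarrow>
      face X (Suc (Suc n)) (Suc i) \<cdot> degen X (Suc n) j = degen X n j \<cdot> face X (Suc n) i"
    using ds_greater[rule_format, of j "Suc i" "Suc n"] by simp
qed

lemma simplicial_map_iff:
  "simplicial_map C X Y f \<longleftrightarrow>
    (\<forall>n. f n \<in> hom C (splx X n) (splx Y n)) \<and>
    (\<forall>n i. i \<le> Suc n \<longrightarrow> f n \<cdot>\<^bsub>C\<^esub> face X (Suc n) i = face Y (Suc n) i \<cdot>\<^bsub>C\<^esub> f (Suc n)) \<and>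
    (\<forall>n i. i \<le> n \<longrightarrow> f (Suc n) \<cdot>\<^bsub>C\<^esub> degen X n i = degen Y n i \<cdot>\<^bsub>C\<^esub> f n)"
proof -
  have "(\<forall>n i. 0 < n \<and> i \<le> n \<longrightarrow> P n i) \<longleftrightarrow> (\<forall>n i. i \<le> Suc n \<longrightarrow> P (Suc n) i)"
    for P :: "nat \<Rightarrow> nat \<Rightarrow> bool"
    by (metis gr0_conv_Suc zero_less_Suc)
  then show ?thesis by (simp add: simplicial_map_def)
qed

section \<open>The category of simplicial objects\<close>

lemma Simp_sel [simp]:
  "Obj (Simp C) = {X. simplicial_object C X}"
  "F \<in> Arr (Simp C) \<longleftrightarrow> simplicial_object C (hsrc F) \<and> simplicial_object C (htgt F) \<and>
    simplicial_map C (hsrc F) (htgt F) (hmap F)"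
  "Dom (Simp C) = hsrc" "Cod (Simp C) = htgt"
  "Idt (Simp C) X = HArr X X (\<lambda>n. Idt C (splx X n))"
  "F' \<cdot>\<^bsub>Simp C\<^esub> F = HArr (hsrc F) (htgt F') (\<lambda>n. hmap F' n \<cdot>\<^bsub>C\<^esub> hmap F n)"
  by (simp_all add: Simp_def)

lemma hom_Simp_iff:
  "F \<in> hom (Simp C) X Y \<longleftrightarrow> hsrc F = X \<and> htgt F = Y \<and>
    simplicial_object C X \<and> simplicial_object C Y \<and> simplicial_map C X Y (hmap F)"
  by (auto simp: hom_def)

context category
begin

lemma simplicial_face_arr [simp]:
  assumes "simplicial_object C X"
  shows "splx X n \<in> Obj C"
    "i \<le> Suc n \<Longrightarrow> face X (Suc n) i \<in> Arr C"
    "i \<le> Suc n \<Longrightarrow> Dom C (face X (Suc n) i) = splx X (Suc n)"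
    "i \<le> Suc n \<Longrightarrow> Cod C (face X (Suc n) i) = splx X n"
    "i \<le> n \<Longrightarrow> degen X n i \<in> Arr C"
    "i \<le> n \<Longrightarrow> Dom C (degen X n i) = splx X n"
    "i \<le> n \<Longrightarrow> Cod C (degen X n i) = splx X (Suc n)"
  using simplicial_objectD(1-3)[OF assms] by (auto simp: hom_def)

lemma simplicial_map_idt:
  "simplicial_object C X \<Longrightarrow> simplicial_map C X X (\<lambda>n. Idt C (splx X n))"
  by (auto simp: simplicial_map_iff hom_def)

lemma simplicial_map_comp:
  assumes X: "simplicial_object C X" and Y: "simplicial_object C Y" and Z: "simplicial_object C Z"
    and f: "simplicial_map C X Y f" and g: "simplicial_map C Y Z g"
  shows "simplicial_map C X Z (\<lambda>n. g n \<cdot> f n)"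
proof -
  have [simp]: "f n \<in> Arr C" "Dom C (f n) = splx X n" "Cod C (f n) = splx Y n"
    "g n \<in> Arr C" "Dom C (g n) = splx Y n" "Cod C (g n) = splx Z n" for n
    using f g by (auto simp: simplicial_map_def hom_def)
  have "(g n \<cdot> f n) \<cdot> face X (Suc n) i = face Z (Suc n) i \<cdot> (g (Suc n) \<cdot> f (Suc n))"
    if "i \<le> Suc n" for n i
  proof -
    have "(g n \<cdot> f n) \<cdot> face X (Suc n) i = g n \<cdot> (face Y (Suc n) i \<cdot> f (Suc n))"
      using that f X by (simp add: simplicial_map_iff)
    also have "\<dots> = (g n \<cdot> face Y (Suc n) i) \<cdot> f (Suc n)"
      using that Y by (simp del: comp_assoc add: comp_assoc[symmetric])
    also have "\<dots> = (face Z (Suc n) i \<cdot> g (Suc n)) \<cdot> f (Suc n)"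
      using that g by (simp add: simplicial_map_iff)
    finally show ?thesis using that Z by simp
  qed
  moreover have "(g (Suc n) \<cdot> f (Suc n)) \<cdot> degen X n i = degen Z n i \<cdot> (g n \<cdot> f n)"
    if "i \<le> n" for n i
  proof -
    have "(g (Suc n) \<cdot> f (Suc n)) \<cdot> degen X n i = g (Suc n) \<cdot> (degen Y n i \<cdot> f n)"
      using that f X by (simp add: simplicial_map_iff)
    also have "\<dots> = (g (Suc n) \<cdot> degen Y n i) \<cdot> f n"
      using that Y by (simp del: comp_assoc add: comp_assoc[symmetric])
    also have "\<dots> = (degen Z n i \<cdot> g n) \<cdot> f n"
      using that g by (simp add: simplicial_map_iff)
    finally show ?thesis using that Z by simp
  qed
  ultimately show ?thesis by (simp add: simplicial_map_iff hom_def)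
qed

lemma category_Simp: "category (Simp C)"
proof
  fix w x y z f g h
  show "f \<in> Arr (Simp C) \<Longrightarrow> Dom (Simp C) f \<in> Obj (Simp C)"
    "f \<in> Arr (Simp C) \<Longrightarrow> Cod (Simp C) f \<in> Obj (Simp C)"
    by auto
  show "x \<in> Obj (Simp C) \<Longrightarrow> Idt (Simp C) x \<in> hom (Simp C) x x"
    by (simp add: hom_Simp_iff simplicial_map_idt)
  show "f \<in> hom (Simp C) x y \<Longrightarrow> g \<in> hom (Simp C) y z \<Longrightarrow> g \<cdot>\<^bsub>Simp C\<^esub> f \<in> hom (Simp C) x z"
    by (auto simp: hom_Simp_iff intro: simplicial_map_comp)
  have *: "hmap f n \<in> hom C (splx a n) (splx b n)" if "f \<in> hom (Simp C) a b" for f a b n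
    using that by (auto simp: hom_Simp_iff simplicial_map_def)
  show "f \<cdot>\<^bsub>Simp C\<^esub> Idt (Simp C) x = f" if "f \<in> hom (Simp C) x y"
    using that Comp_Idt[OF *[OF that]] by (cases f) (auto simp: hom_Simp_iff)
  show "Idt (Simp C) y \<cdot>\<^bsub>Simp C\<^esub> f = f" if "f \<in> hom (Simp C) x y"
    using that Idt_Comp[OF *[OF that]] by (cases f) (auto simp: hom_Simp_iff)
  show "(h \<cdot>\<^bsub>Simp C\<^esub> g) \<cdot>\<^bsub>Simp C\<^esub> f = h \<cdot>\<^bsub>Simp C\<^esub> (g \<cdot>\<^bsub>Simp C\<^esub> f)"
    if "f \<in> hom (Simp C) w x" "g \<in> hom (Simp C) x y" "h \<in> hom (Simp C) y z"
    using Comp_assoc[OF *[OF that(1)] *[OF that(2)] *[OF that(3)]] by simp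
qed

end

section \<open>Composite functors and functors applied degreewise\<close>

lemma cat_functor_comp:
  assumes "cat_functor C D F" "cat_functor D E G"
  shows "cat_functor C E (ftr_comp G F)"
proof -
  interpret F: cat_functor C D F by fact
  interpret G: cat_functor D E G by fact
  show ?thesis
    by unfold_locales
      (auto simp: ftr_comp_def F.fobj_Obj G.fobj_Obj F.farr_Idt G.farr_Idt
        F.farr_Comp G.farr_Comp[OF F.farr_hom F.farr_hom] intro: G.farr_hom F.farr_hom)
qed

lemma cat_functor_id: "category C \<Longrightarrow> cat_functor C C ftr_id"
  by (simp add: cat_functor_def cat_functor_axioms_def ftr_id_def)

lemma (in cat_functor) simplicial_object_ftr:
  assumes X: "simplicial_object C X"
  shows "simplicial_object D (simp_ftr_obj F X)"
proof -
  note h = simplicial_objectD[OF X]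
  \<comment> \<open>Functoriality is read backwards: two images are gathered into the image of one
    composite, where the identity of \<open>X\<close> applies.\<close>
  note c = farr_Comp[symmetric]
  show ?thesis
    unfolding simp_ftr_obj_def
    by (rule simplicial_object_mk_sobjI)
      (auto simp: h(4-9) farr_Idt h(1) c[OF h(2) h(2)] c[OF h(3) h(3)] c[OF h(2) h(3)] c[OF h(3) h(2)]
         intro!: fobj_Obj farr_hom h(1-3))
qed

lemma (in cat_functor) cat_functor_simp_ftr: "cat_functor (Simp C) (Simp D) (simp_ftr F)"
proof -
  interpret SC: category "Simp C" by (rule C.category_Simp)
  interpret SD: category "Simp D" by (rule D.category_Simp)
  show ?thesis
  proof
    fix x y z f g
    show "x \<in> Obj (Simp C) \<Longrightarrow> fobj (simp_ftr F) x \<in> Obj (Simp D)"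
      by (simp add: simp_ftr_def simplicial_object_ftr)
    show "x \<in> Obj (Simp C) \<Longrightarrow>
        farr (simp_ftr F) (Idt (Simp C) x) = Idt (Simp D) (fobj (simp_ftr F) x)"
      by (simp add: simp_ftr_def simp_ftr_obj_def farr_Idt)
    have *: "hmap f n \<in> hom C (splx a n) (splx b n)" if "f \<in> hom (Simp C) a b" for f a b n
      using that by (auto simp: hom_Simp_iff simplicial_map_def)
    show "farr (simp_ftr F) (g \<cdot>\<^bsub>Simp C\<^esub> f) = farr (simp_ftr F) g \<cdot>\<^bsub>Simp D\<^esub> farr (simp_ftr F) f"
      if "f \<in> hom (Simp C) x y" "g \<in> hom (Simp C) y z"
      using farr_Comp[OF *[OF that(1)] *[OF that(2)]] by (simp add: simp_ftr_def)
    show "farr (simp_ftr F) f \<in> hom (Simp D) (fobj (simp_ftr F) x) (fobj (simp_ftr F) y)"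
      if f: "f \<in> hom (Simp C) x y"
    proof -
      have x: "simplicial_object C x" and y: "simplicial_object C y"
        and m: "simplicial_map C x y (hmap f)"
        using f by (auto simp: hom_Simp_iff)
      note hx = simplicial_objectD[OF x] and hy = simplicial_objectD[OF y]
      note c = farr_Comp[symmetric]
      have "simplicial_map D (simp_ftr_obj F x) (simp_ftr_obj F y) (\<lambda>n. farr F (hmap f n))"
        using m unfolding simplicial_map_iff
        by (auto simp: simp_ftr_obj_def c[OF hx(2) *[OF f]] c[OF hx(3) *[OF f]]
            c[OF *[OF f] hy(2)] c[OF *[OF f] hy(3)] intro!: farr_hom *[OF f])
      then show ?thesis
        using f x y by (simp add: hom_Simp_iff simp_ftr_def simplicial_object_ftr)
    qed
  qed
qed

section \<open>Products and group objects\<close>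

context finite_product_category
begin

section \<open>Finite products and tuples\<close>

lemma prod_obj [simp]: "set as \<subseteq> Obj C \<Longrightarrow> Prod C as \<in> Obj C"
  using product by (auto simp: is_product_def)

lemma proj_arr [simp]:
  assumes "set as \<subseteq> Obj C" "k < length as"
  shows "Proj C as k \<in> Arr C" "Dom C (Proj C as k) = Prod C as" "Cod C (Proj C as k) = as ! k"
  using product[OF assms(1)] assms(2) by (auto simp: is_product_def hom_def)

lemma ex1_tuple:
  assumes "x \<in> Obj C" "\<forall>f \<in> set fs. f \<in> Arr C \<and> Dom C f = x"
  shows "\<exists>!h. h \<in> hom C x (Prod C (map (Cod C) fs)) \<and>
    (\<forall>k < length fs. Proj C (map (Cod C) fs) k \<cdot> h = fs ! k)"
proof -
  have "set (map (Cod C) fs) \<subseteq> Obj C" using assms by auto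
  from product[OF this] have "\<forall>gs. length gs = length fs \<longrightarrow>
      (\<forall>k < length fs. gs ! k \<in> hom C x (map (Cod C) fs ! k)) \<longrightarrow>
      (\<exists>!h. h \<in> hom C x (Prod C (map (Cod C) fs)) \<and>
        (\<forall>k < length fs. Proj C (map (Cod C) fs) k \<cdot> h = gs ! k))"
    using assms(1) by (simp add: is_product_def)
  from this[rule_format, of fs] show ?thesis
    using assms(2) by (simp add: hom_def)
qed

lemma tuple_arr:
  assumes "x \<in> Obj C" "\<forall>f \<in> set fs. f \<in> Arr C \<and> Dom C f = x"
  shows "tuple C x fs \<in> Arr C" "Dom C (tuple C x fs) = x"
    "Cod C (tuple C x fs) = Prod C (map (Cod C) fs)"
    "k < length fs \<Longrightarrow> Proj C (map (Cod C) fs) k \<cdot> tuple C x fs = fs ! k"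
  using theI'[OF ex1_tuple[OF assms]] by (auto simp: tuple_def hom_def)

text \<open>The projections are jointly monic: \<open>h\<close> and \<open>h'\<close> both solve the
  universal problem posed by the components of \<open>h\<close>. For the empty list this is
  uniqueness of arrows into the terminal object.\<close>

lemma prod_eqI:
  assumes "h \<in> Arr C" "h' \<in> Arr C" "Dom C h = Dom C h'" "Cod C h = Prod C as" "Cod C h' = Prod C as"
    and as: "set as \<subseteq> Obj C"
    and eq: "\<And>k. k < length as \<Longrightarrow> Proj C as k \<cdot> h = Proj C as k \<cdot> h'"
  shows "h = h'"
proof -
  let ?fs = "map (\<lambda>k. Proj C as k \<cdot> h) [0..<length as]"
  have fs: "\<forall>k<length as. ?fs ! k \<in> hom C (Dom C h) (as ! k)"
    using assms by (auto simp: hom_def)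
  have "\<exists>!g. g \<in> hom C (Dom C h) (Prod C as) \<and> (\<forall>k<length as. Proj C as k \<cdot> g = ?fs ! k)"
  proof -
    have "\<forall>fs. length fs = length as \<longrightarrow> (\<forall>k<length as. fs ! k \<in> hom C (Dom C h) (as ! k)) \<longrightarrow>
        (\<exists>!g. g \<in> hom C (Dom C h) (Prod C as) \<and> (\<forall>k<length as. Proj C as k \<cdot> g = fs ! k))"
      using product[OF as] \<open>h \<in> Arr C\<close> by (simp add: is_product_def)
    from this[rule_format, of ?fs] show ?thesis using fs by simp
  qed
  moreover have "h \<in> hom C (Dom C h) (Prod C as)" "h' \<in> hom C (Dom C h) (Prod C as)"
    using assms by (auto simp: hom_def)
  moreover have "\<forall>k<length as. Proj C as k \<cdot> h = ?fs ! k" "\<forall>k<length as. Proj C as k \<cdot> h' = ?fs ! k"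
    using eq by auto
  ultimately show ?thesis by metis
qed

lemma pair_arr [simp]:
  assumes "a \<in> Arr C" "b \<in> Arr C" "Dom C a = x" "Dom C b = x"
  shows "tuple C x [a, b] \<in> Arr C" "Dom C (tuple C x [a, b]) = x"
    "Cod C (tuple C x [a, b]) = Prod C [Cod C a, Cod C b]"
    "Cod C a = c \<Longrightarrow> Cod C b = c' \<Longrightarrow> Proj C [c, c'] 0 \<cdot> tuple C x [a, b] = a"
    "Cod C a = c \<Longrightarrow> Cod C b = c' \<Longrightarrow> Proj C [c, c'] (Suc 0) \<cdot> tuple C x [a, b] = b"
proof -
  have "x \<in> Obj C" using assms by auto
  moreover have "\<forall>f \<in> set [a, b]. f \<in> Arr C \<and> Dom C f = x" using assms by simp
  ultimately have t: "tuple C x [a, b] \<in> Arr C" "Dom C (tuple C x [a, b]) = x"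
    "Cod C (tuple C x [a, b]) = Prod C (map (Cod C) [a, b])"
    "\<And>k. k < length [a, b] \<Longrightarrow> Proj C (map (Cod C) [a, b]) k \<cdot> tuple C x [a, b] = [a, b] ! k"
    using tuple_arr by blast+
  from t(1-3) t(4)[of 0] t(4)[of "Suc 0"]
  show "tuple C x [a, b] \<in> Arr C" "Dom C (tuple C x [a, b]) = x"
    "Cod C (tuple C x [a, b]) = Prod C [Cod C a, Cod C b]"
    "Cod C a = c \<Longrightarrow> Cod C b = c' \<Longrightarrow> Proj C [c, c'] 0 \<cdot> tuple C x [a, b] = a"
    "Cod C a = c \<Longrightarrow> Cod C b = c' \<Longrightarrow> Proj C [c, c'] (Suc 0) \<cdot> tuple C x [a, b] = b"
    by simp_all
qed

lemma pair_comp: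
  assumes "a \<in> Arr C" "b \<in> Arr C" "Dom C a = x" "Dom C b = x" "h \<in> Arr C" "Cod C h = x"
  shows "tuple C x [a, b] \<cdot> h = tuple C (Dom C h) [a \<cdot> h, b \<cdot> h]"
proof (rule prod_eqI[where as = "[Cod C a, Cod C b]"])
  fix k assume "k < length [Cod C a, Cod C b]"
  then have "k = 0 \<or> k = Suc 0" by auto
  then show "Proj C [Cod C a, Cod C b] k \<cdot> (tuple C x [a, b] \<cdot> h) =
      Proj C [Cod C a, Cod C b] k \<cdot> tuple C (Dom C h) [a \<cdot> h, b \<cdot> h]"
    using assms by (auto simp: comp_assoc[symmetric] simp del: comp_assoc)
qed (use assms in auto)

lemma empty_tuple_arr [simp]:
  assumes "x \<in> Obj C"
  shows "tuple C x [] \<in> Arr C" "Dom C (tuple C x []) = x" "Cod C (tuple C x []) = Prod C []"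
  using tuple_arr[of x "[]"] assms by auto

lemma empty_tuple_comp:
  assumes "h \<in> Arr C" "Cod C h = x"
  shows "tuple C x [] \<cdot> h = tuple C (Dom C h) []"
  by (rule prod_eqI[where as = "[]"]) (use assms in auto)

section \<open>Group objects in terms of generalised elements\<close>

lemma group_object_arr [simp]:
  assumes "group_object C G"
  shows "gcar G \<in> Obj C"
    "gmult G \<in> Arr C" "Dom C (gmult G) = Prod C [gcar G, gcar G]" "Cod C (gmult G) = gcar G"
    "gunit G \<in> Arr C" "Dom C (gunit G) = Prod C []" "Cod C (gunit G) = gcar G"
    "ginv G \<in> Arr C" "Dom C (ginv G) = gcar G" "Cod C (ginv G) = gcar G"
  using assms by (auto simp: group_object_def Let_def hom_def)

lemma gmul_arr [simp]:
  assumes "group_object C G" "a \<in> Arr C" "b \<in> Arr C" "Dom C b = Dom C a"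
    "Cod C a = gcar G" "Cod C b = gcar G"
  shows "gmul C G a b \<in> Arr C" "Dom C (gmul C G a b) = Dom C a" "Cod C (gmul C G a b) = gcar G"
  using assms by (auto simp: gmul_def)

text \<open>Multiplication of generalised elements is stable under change of stage. This is what
  allows an identity for universal elements to be specialised by precomposition.\<close>

lemma gmul_comp [simp]:
  assumes "group_object C G" "a \<in> Arr C" "b \<in> Arr C" "Dom C b = Dom C a"
    "Cod C a = gcar G" "Cod C b = gcar G" "h \<in> Arr C" "Dom C a = Cod C h"
  shows "gmul C G a b \<cdot> h = gmul C G (a \<cdot> h) (b \<cdot> h)"
  using assms by (simp add: gmul_def pair_comp)

lemma gone_arr [simp]:
  assumes "group_object C G" "x \<in> Obj C"
  shows "gone C G x \<in> Arr C" "Dom C (gone C G x) = x" "Cod C (gone C G x) = gcar G"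
  using assms by (auto simp: gone_def)

lemma gone_comp [simp]:
  assumes "group_object C G" "h \<in> Arr C" "Cod C h = x"
  shows "gone C G x \<cdot> h = gone C G (Dom C h)"
  using assms dom_cod_obj(2)[of h] by (simp add: gone_def empty_tuple_comp del: dom_cod_obj)

text \<open>The axiom speaks only of the three projections of G x G x G. These form the universal
  triple, and composing with the tuple of \<open>a\<close>, \<open>b\<close>, \<open>c\<close>
  specialises the axiom to an arbitrary one.\<close>

lemma gmul_assoc:
  assumes G: "group_object C G" and a: "a \<in> Arr C" "Cod C a = gcar G"
    and b: "b \<in> Arr C" "Cod C b = gcar G" "Dom C b = Dom C a"
    and c: "c \<in> Arr C" "Cod C c = gcar G" "Dom C c = Dom C a"
  shows "gmul C G (gmul C G a b) c = gmul C G a (gmul C G b c)"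
proof -
  let ?g = "gcar G" and ?t = "tuple C (Dom C a) [a, b, c]"
  let ?p = "Proj C [?g, ?g, ?g]"
  have "\<forall>f \<in> set [a, b, c]. f \<in> Arr C \<and> Dom C f = Dom C a"
    using a b c by simp
  note t' = tuple_arr[OF dom_cod_obj(1)[OF a(1)] this]
  have t: "?t \<in> Arr C" "Dom C ?t = Dom C a" "Cod C ?t = Prod C [?g, ?g, ?g]"
    using t'(1-3) a b c by simp_all
  have pt: "?p 0 \<cdot> ?t = a" "?p (Suc 0) \<cdot> ?t = b" "?p 2 \<cdot> ?t = c"
    using t'(4)[of 0] t'(4)[of "Suc 0"] t'(4)[of 2] a b c by simp_all
  have "gmul C G (gmul C G (?p 0) (?p (Suc 0))) (?p 2) \<cdot> ?t =
      gmul C G (?p 0) (gmul C G (?p (Suc 0)) (?p 2)) \<cdot> ?t"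
    using G by (simp add: group_object_def Let_def)
  then show ?thesis using G t by (simp add: pt)
qed

text \<open>Here the universal element is the identity arrow of the carrier, and composing the
  axioms with \<open>a\<close> yields the laws for \<open>a\<close>.\<close>

lemma gmul_unit_inv:
  assumes G: "group_object C G" and a: "a \<in> Arr C" "Cod C a = gcar G" "Dom C a = x"
  shows "gmul C G (gone C G x) a = a" "gmul C G a (gone C G x) = a"
    "gmul C G (ginv G \<cdot> a) a = gone C G x" "gmul C G a (ginv G \<cdot> a) = gone C G x"
proof -
  let ?e = "Idt C (gcar G)" and ?o = "gone C G (gcar G)"
  have "gmul C G ?o ?e \<cdot> a = ?e \<cdot> a" "gmul C G ?e ?o \<cdot> a = ?e \<cdot> a"
    "gmul C G (ginv G) ?e \<cdot> a = ?o \<cdot> a" "gmul C G ?e (ginv G) \<cdot> a = ?o \<cdot> a"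
    using G by (simp_all add: group_object_def Let_def)
  then show "gmul C G (gone C G x) a = a" "gmul C G a (gone C G x) = a"
    "gmul C G (ginv G \<cdot> a) a = gone C G x" "gmul C G a (ginv G \<cdot> a) = gone C G x"
    using G a by simp_all
qed

text \<open>These two cancellations are what makes \<open>theta\<close> and \<open>theta_inv\<close>
  mutually inverse.\<close>

lemma gmul_inv_cancel:
  assumes G: "group_object C G" and a: "a \<in> Arr C" "Cod C a = gcar G"
    and b: "b \<in> Arr C" "Cod C b = gcar G" "Dom C b = Dom C a"
  shows "gmul C G a (gmul C G (ginv G \<cdot> a) b) = b" "gmul C G (ginv G \<cdot> a) (gmul C G a b) = b"
  using assms by (simp_all add: gmul_assoc[symmetric] gmul_unit_inv)

lemma group_hom_arr:
  assumes "group_hom C G H f"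
  shows "f \<in> Arr C" "Dom C f = gcar G" "Cod C f = gcar H"
  using assms by (auto simp: group_hom_def hom_def)

lemma group_hom_gmul:
  assumes f: "group_hom C G H f" and G: "group_object C G" and H: "group_object C H"
    and a: "a \<in> Arr C" "Cod C a = gcar G" and b: "b \<in> Arr C" "Cod C b = gcar G" "Dom C b = Dom C a"
  shows "f \<cdot> gmul C G a b = gmul C H (f \<cdot> a) (f \<cdot> b)"
proof -
  let ?g = "gcar G" and ?t = "tuple C (Dom C a) [a, b]"
  note [simp] = group_hom_arr[OF f]
  have "f \<cdot> gmult G = gmul C H (f \<cdot> Proj C [?g, ?g] 0) (f \<cdot> Proj C [?g, ?g] (Suc 0))"
    using f by (simp add: group_hom_def Let_def)
  then have "(f \<cdot> gmult G) \<cdot> ?t = gmul C H (f \<cdot> Proj C [?g, ?g] 0) (f \<cdot> Proj C [?g, ?g] (Suc 0)) \<cdot> ?t"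
    by simp
  then show ?thesis using G H a b by (simp add: gmul_def[of C G])
qed

text \<open>Multiplicativity on all pairs is tested on the universal pair of projections, which
  recovers the equation of arrows in the definition.\<close>

lemma group_homI:
  assumes G: "group_object C G" and f: "f \<in> Arr C" "Dom C f = gcar G" "Cod C f = gcar H"
    and mult: "\<And>a b. a \<in> Arr C \<Longrightarrow> Cod C a = gcar G \<Longrightarrow> b \<in> Arr C \<Longrightarrow> Cod C b = gcar G \<Longrightarrow>
      Dom C b = Dom C a \<Longrightarrow> f \<cdot> gmul C G a b = gmul C H (f \<cdot> a) (f \<cdot> b)"
  shows "group_hom C G H f"
proof -
  let ?g = "gcar G"
  let ?p = "Proj C [?g, ?g]"
  \<comment> \<open>The pair of both projections is the identity of the product, so the product of
    the two universal elements is \<open>gmult G\<close> itself.\<close>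
  have "tuple C (Prod C [?g, ?g]) [?p 0, ?p (Suc 0)] = Idt C (Prod C [?g, ?g])"
  proof (rule prod_eqI[where as = "[?g, ?g]"])
    fix k assume "k < length [?g, ?g]"
    then have "k = 0 \<or> k = Suc 0" by auto
    then show "?p k \<cdot> tuple C (Prod C [?g, ?g]) [?p 0, ?p (Suc 0)] = ?p k \<cdot> Idt C (Prod C [?g, ?g])"
      using G by auto
  qed (use G in auto)
  then have "gmul C G (?p 0) (?p (Suc 0)) = gmult G"
    using G by (simp add: gmul_def)
  then show ?thesis
    using mult[of "?p 0" "?p (Suc 0)"] G f by (simp add: group_hom_def Let_def hom_def)
qed

lemma group_hom_idt: "group_object C G \<Longrightarrow> group_hom C G G (Idt C (gcar G))"
  by (rule group_homI) auto

lemma group_hom_comp: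
  assumes "group_object C G" "group_object C H" "group_object C K"
    and f: "group_hom C G H f" and g: "group_hom C H K g"
  shows "group_hom C G K (g \<cdot> f)"
proof (rule group_homI)
  note [simp] = group_hom_arr[OF f] group_hom_arr[OF g]
  show "g \<cdot> f \<in> Arr C" "Dom C (g \<cdot> f) = gcar G" "Cod C (g \<cdot> f) = gcar K" by simp_all
  show "(g \<cdot> f) \<cdot> gmul C G a b = gmul C K ((g \<cdot> f) \<cdot> a) ((g \<cdot> f) \<cdot> b)"
    if "a \<in> Arr C" "Cod C a = gcar G" "b \<in> Arr C" "Cod C b = gcar G" "Dom C b = Dom C a" for a b
    using that assms by (simp add: group_hom_gmul[OF f] group_hom_gmul[OF g])
qed fact

end

section \<open>The category of group objects\<close>

lemma Grp_sel [simp]: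
  "Obj (Grp C) = {G. group_object C G}"
  "F \<in> Arr (Grp C) \<longleftrightarrow> group_object C (hsrc F) \<and> group_object C (htgt F) \<and>
    group_hom C (hsrc F) (htgt F) (hmap F)"
  "Dom (Grp C) = hsrc" "Cod (Grp C) = htgt"
  "Idt (Grp C) G = HArr G G (Idt C (gcar G))"
  "F' \<cdot>\<^bsub>Grp C\<^esub> F = HArr (hsrc F) (htgt F') (hmap F' \<cdot>\<^bsub>C\<^esub> hmap F)"
  by (simp_all add: Grp_def)

lemma hom_Grp_iff:
  "F \<in> hom (Grp C) G H \<longleftrightarrow> hsrc F = G \<and> htgt F = H \<and>
    group_object C G \<and> group_object C H \<and> group_hom C G H (hmap F)"
  by (auto simp: hom_def)

context finite_product_category
begin

lemma category_Grp: "category (Grp C)"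
proof
  fix w x y z f g h
  show "f \<in> Arr (Grp C) \<Longrightarrow> Dom (Grp C) f \<in> Obj (Grp C)"
    "f \<in> Arr (Grp C) \<Longrightarrow> Cod (Grp C) f \<in> Obj (Grp C)"
    by auto
  show "x \<in> Obj (Grp C) \<Longrightarrow> Idt (Grp C) x \<in> hom (Grp C) x x"
    by (simp add: hom_Grp_iff group_hom_idt)
  show "f \<in> hom (Grp C) x y \<Longrightarrow> g \<in> hom (Grp C) y z \<Longrightarrow> g \<cdot>\<^bsub>Grp C\<^esub> f \<in> hom (Grp C) x z"
    by (auto simp: hom_Grp_iff intro: group_hom_comp)
  show "f \<cdot>\<^bsub>Grp C\<^esub> Idt (Grp C) x = f" if "f \<in> hom (Grp C) x y"
    using that by (cases f) (auto simp: hom_Grp_iff group_hom_arr)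
  show "Idt (Grp C) y \<cdot>\<^bsub>Grp C\<^esub> f = f" if "f \<in> hom (Grp C) x y"
    using that by (cases f) (auto simp: hom_Grp_iff group_hom_arr)
  show "(h \<cdot>\<^bsub>Grp C\<^esub> g) \<cdot>\<^bsub>Grp C\<^esub> f = h \<cdot>\<^bsub>Grp C\<^esub> (g \<cdot>\<^bsub>Grp C\<^esub> f)"
    if "f \<in> hom (Grp C) w x" "g \<in> hom (Grp C) x y" "h \<in> hom (Grp C) y z"
    using that group_hom_arr[of w x "hmap f"] group_hom_arr[of x y "hmap g"]
      group_hom_arr[of y z "hmap h"] by (simp add: hom_Grp_iff)
qed

lemma cat_functor_forget_sGrp: "cat_functor (sGrp C) (Simp C) forget_sGrp"
proof -
  interpret Grp: category "Grp C" by (rule category_Grp)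
  have "cat_functor (Grp C) C forget_Grp"
    by unfold_locales (auto simp: forget_Grp_def hom_Grp_iff group_hom_def)
  then show ?thesis
    unfolding forget_sGrp_def by (rule cat_functor.cat_functor_simp_ftr)
qed

end

section \<open>The simplicial group \<open>Wgr\<close>\<close>

abbreviation car :: "('o, 'm) sgrp \<Rightarrow> nat \<Rightarrow> 'o" where
  "car G n \<equiv> gcar (splx G n)"

abbreviation gface :: "('o, 'm) sgrp \<Rightarrow> nat \<Rightarrow> nat \<Rightarrow> 'm" where
  "gface G n i \<equiv> hmap (face G n i)"

abbreviation gdegen :: "('o, 'm) sgrp \<Rightarrow> nat \<Rightarrow> nat \<Rightarrow> 'm" where
  "gdegen G n i \<equiv> hmap (degen G n i)"

text \<open>Entries are indexed by the degree \<open>k\<close> of their group instead of their list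
  position \<open>n - k\<close>, so that all formulas for W and Wgr become functions of
  \<open>k\<close>.\<close>

definition W_tuple :: "('o, 'm, 'z) fp_cat_scheme \<Rightarrow> 'o \<Rightarrow> nat \<Rightarrow> (nat \<Rightarrow> 'm) \<Rightarrow> 'm" where
  "W_tuple C x n a = tuple C x (map a (rev [0..<Suc n]))"

lemma W_objs_length_nth [simp]:
  "length (W_objs G n) = Suc n"
  "k \<le> n \<Longrightarrow> W_objs G n ! (n - k) = car G k"
  by (auto simp: W_objs_def rev_nth simp del: upt_Suc)

lemma tuple_eq_W_tuple:
  assumes "length fs = Suc n" "\<And>k. k \<le> n \<Longrightarrow> fs ! (n - k) = a k"
  shows "tuple C x fs = W_tuple C x n a"
proof -
  have "fs = map a (rev [0..<Suc n])"
  proof (rule nth_equalityI)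
    fix j assume "j < length fs"
    then show "fs ! j = map a (rev [0..<Suc n]) ! j"
      using assms(1) assms(2)[of "n - j"] by (auto simp: rev_nth simp del: upt_Suc)
  qed (use assms(1) in simp)
  then show ?thesis by (simp add: W_tuple_def)
qed

text \<open>List position \<open>j\<close> carries degree \<open>k = n - j\<close>. Hence the block
  \<open>j < i\<close> becomes \<open>n < i + k\<close>, and the index \<open>i - j\<close> becomes
  \<open>i + k - n\<close>, the position of vertex \<open>i\<close> within the final segment on
  which entry \<open>k + 1\<close> lives.\<close>

lemma Wgr_face_eq:
  assumes "i \<le> Suc n"
  shows "Wgr_face C G (Suc n) i = W_tuple C (W_space C G (Suc n)) n
    (\<lambda>k. if n < i + k then gface G (Suc k) (i + k - n) \<cdot>\<^bsub>C\<^esub> W_el C G (Suc n) (Suc k)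
      else W_el C G (Suc n) k)"
  unfolding Wgr_face_def Let_def using assms
  by (intro tuple_eq_W_tuple) (auto simp: nth_append rev_nth Suc_diff_le simp del: upt_Suc)

text \<open>The truncated \<open>k - 1\<close> is harmless: \<open>n < i + k\<close> and
  \<open>i \<le> n\<close> force \<open>0 < k\<close>, so the first branch never meets
  \<open>k = 0\<close>.\<close>

lemma Wgr_degen_eq:
  assumes "i \<le> n"
  shows "Wgr_degen C G n i = W_tuple C (W_space C G n) (Suc n)
    (\<lambda>k. if n < i + k then gdegen G (k - 1) (i + k - Suc n) \<cdot>\<^bsub>C\<^esub> W_el C G n (k - 1)
      else W_el C G n k)"
  unfolding Wgr_degen_def Let_def using assms
  by (intro tuple_eq_W_tuple) (auto simp: nth_append rev_nth simp del: upt_Suc)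

text \<open>The additional middle case \<open>n = i + k\<close> is the single position where W
  multiplies two neighbours. It never occurs for the last face \<open>i = Suc n\<close>, which has
  no such product.\<close>

lemma W_face_eq:
  assumes "i \<le> Suc n"
  shows "W_face C G (Suc n) i = W_tuple C (W_space C G (Suc n)) n
    (\<lambda>k. if n < i + k then gface G (Suc k) (i + k - n) \<cdot>\<^bsub>C\<^esub> W_el C G (Suc n) (Suc k)
      else if n = i + k
      then gmul C (splx G k) (gface G (Suc k) 0 \<cdot>\<^bsub>C\<^esub> W_el C G (Suc n) (Suc k)) (W_el C G (Suc n) k)
      else W_el C G (Suc n) k)"
  unfolding W_face_def Let_def using assms
  by (intro tuple_eq_W_tuple) (auto simp: nth_append rev_nth Suc_diff_le simp del: upt_Suc)

lemma W_degen_eq: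
  assumes "i \<le> n"
  shows "W_degen C G n i = W_tuple C (W_space C G n) (Suc n)
    (\<lambda>k. if n < i + k then gdegen G (k - 1) (i + k - Suc n) \<cdot>\<^bsub>C\<^esub> W_el C G n (k - 1)
      else if n = i + k then gone C (splx G k) (W_space C G n)
      else W_el C G n k)"
  unfolding W_degen_def Let_def using assms
  by (intro tuple_eq_W_tuple) (auto simp: nth_append rev_nth simp del: upt_Suc)

lemma W_map_eq:
  "W_map C F n = W_tuple C (W_space C (hsrc F) n) n (\<lambda>k. hmap (hmap F k) \<cdot>\<^bsub>C\<^esub> W_el C (hsrc F) n k)"
  by (simp add: W_map_def W_tuple_def)

lemma Wgr_group_sel:
  "gcar (Wgr_group C G n) = W_space C G n"
  "gmult (Wgr_group C G n) = (let w = W_space C G n; p = Proj C [w, w] in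
    W_tuple C (Prod C [w, w]) n (\<lambda>k. gmul C (splx G k) (W_el C G n k \<cdot>\<^bsub>C\<^esub> p 0) (W_el C G n k \<cdot>\<^bsub>C\<^esub> p 1)))"
  "gunit (Wgr_group C G n) = W_tuple C (Prod C []) n (\<lambda>k. gunit (splx G k))"
  "ginv (Wgr_group C G n) = W_tuple C (W_space C G n) n (\<lambda>k. ginv (splx G k) \<cdot>\<^bsub>C\<^esub> W_el C G n k)"
  by (simp_all add: Wgr_group_def W_tuple_def Let_def)

declare Wgr_group_sel(1) [simp]

context finite_product_category
begin

context
  fixes G :: "('o, 'm) sgrp"
  assumes G [simp]: "simplicial_object (Grp C) G"
begin

section \<open>Structure maps of a simplicial group on generalised elements\<close>

lemma sgrp_group [simp]: "group_object C (splx G n)"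
  using simplicial_objectD(1)[OF G] by simp

lemma gface_hom: "i \<le> Suc n \<Longrightarrow> group_hom C (splx G (Suc n)) (splx G n) (gface G (Suc n) i)"
  and gdegen_hom: "i \<le> n \<Longrightarrow> group_hom C (splx G n) (splx G (Suc n)) (gdegen G n i)"
  using simplicial_objectD(2,3)[OF G] by (auto simp: hom_Grp_iff)

lemma gface_arr [simp]:
  assumes "i \<le> Suc n"
  shows "gface G (Suc n) i \<in> Arr C" "Dom C (gface G (Suc n) i) = car G (Suc n)"
    "Cod C (gface G (Suc n) i) = car G n"
  using group_hom_arr[OF gface_hom[OF assms]] by auto

lemma gdegen_arr [simp]:
  assumes "i \<le> n"
  shows "gdegen G n i \<in> Arr C" "Dom C (gdegen G n i) = car G n"
    "Cod C (gdegen G n i) = car G (Suc n)"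
  using group_hom_arr[OF gdegen_hom[OF assms]] by auto

lemma gface_gmul [simp]:
  assumes "i \<le> Suc n" "a \<in> Arr C" "Cod C a = car G (Suc n)"
    "b \<in> Arr C" "Cod C b = car G (Suc n)" "Dom C b = Dom C a"
  shows "gface G (Suc n) i \<cdot> gmul C (splx G (Suc n)) a b =
    gmul C (splx G n) (gface G (Suc n) i \<cdot> a) (gface G (Suc n) i \<cdot> b)"
  using assms by (intro group_hom_gmul[OF gface_hom]) auto

lemma gdegen_gmul [simp]:
  assumes "i \<le> n" "a \<in> Arr C" "Cod C a = car G n"
    "b \<in> Arr C" "Cod C b = car G n" "Dom C b = Dom C a"
  shows "gdegen G n i \<cdot> gmul C (splx G n) a b =
    gmul C (splx G (Suc n)) (gdegen G n i \<cdot> a) (gdegen G n i \<cdot> b)"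
  using assms by (intro group_hom_gmul[OF gdegen_hom]) auto

text \<open>The identity lives in \<open>Grp C\<close>; its underlying equation is composed with
  \<open>a\<close> to fit right-normalised composites. The form \<open>i < j\<close> with
  \<open>j - 1\<close> is chosen because the indices met later are differences such as
  \<open>i + k - n\<close>, which need not be written as successors.\<close>

lemma gface_gface:
  assumes "i < j" "j \<le> Suc (Suc n)" "a \<in> Arr C" "Cod C a = car G (Suc (Suc n))"
  shows "gface G (Suc n) i \<cdot> (gface G (Suc (Suc n)) j \<cdot> a) =
    gface G (Suc n) (j - 1) \<cdot> (gface G (Suc (Suc n)) i \<cdot> a)"
proof -
  have "gface G (Suc n) i \<cdot> gface G (Suc (Suc n)) j = gface G (Suc n) (j - 1) \<cdot> gface G (Suc (Suc n)) i"
    using arg_cong[OF simplicial_objectD(4)[OF G, of i "j - 1" n], of hmap] assms by simp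
  from arg_cong[OF this, of "\<lambda>h. h \<cdot> a"] show ?thesis using assms by simp
qed

lemma gdegen_gdegen:
  assumes "i \<le> j" "j \<le> n" "a \<in> Arr C" "Cod C a = car G n"
  shows "gdegen G (Suc n) i \<cdot> (gdegen G n j \<cdot> a) = gdegen G (Suc n) (Suc j) \<cdot> (gdegen G n i \<cdot> a)"
proof -
  have "gdegen G (Suc n) i \<cdot> gdegen G n j = gdegen G (Suc n) (Suc j) \<cdot> gdegen G n i"
    using arg_cong[OF simplicial_objectD(5)[OF G, of i j n], of hmap] assms by simp
  from arg_cong[OF this, of "\<lambda>h. h \<cdot> a"] show ?thesis using assms by simp
qed

lemma gface_gdegen_less:
  assumes "i < j" "j \<le> Suc n" "a \<in> Arr C" "Cod C a = car G (Suc n)"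
  shows "gface G (Suc (Suc n)) i \<cdot> (gdegen G (Suc n) j \<cdot> a) =
    gdegen G n (j - 1) \<cdot> (gface G (Suc n) i \<cdot> a)"
proof -
  have "gface G (Suc (Suc n)) i \<cdot> gdegen G (Suc n) j = gdegen G n (j - 1) \<cdot> gface G (Suc n) i"
    using arg_cong[OF simplicial_objectD(6)[OF G, of i "j - 1" n], of hmap] assms by simp
  from arg_cong[OF this, of "\<lambda>h. h \<cdot> a"] show ?thesis using assms by simp
qed

lemma gface_gdegen_cancel:
  assumes "j \<le> n" "i = j \<or> i = Suc j" "a \<in> Arr C" "Cod C a = car G n"
  shows "gface G (Suc n) i \<cdot> (gdegen G n j \<cdot> a) = a"
proof -
  have "gface G (Suc n) i \<cdot> gdegen G n j = Idt C (car G n)"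
    using arg_cong[OF simplicial_objectD(7)[OF G, of j n], of hmap]
      arg_cong[OF simplicial_objectD(8)[OF G, of j n], of hmap] assms by auto
  from arg_cong[OF this, of "\<lambda>h. h \<cdot> a"] show ?thesis using assms by auto
qed

lemma gface_gdegen_greater:
  assumes "Suc j < i" "i \<le> Suc (Suc n)" "a \<in> Arr C" "Cod C a = car G (Suc n)"
  shows "gface G (Suc (Suc n)) i \<cdot> (gdegen G (Suc n) j \<cdot> a) =
    gdegen G n j \<cdot> (gface G (Suc n) (i - 1) \<cdot> a)"
proof -
  have "gface G (Suc (Suc n)) i \<cdot> gdegen G (Suc n) j = gdegen G n j \<cdot> gface G (Suc n) (i - 1)"
    using arg_cong[OF simplicial_objectD(9)[OF G, of j "i - 1" n], of hmap] assms by simp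
  from arg_cong[OF this, of "\<lambda>h. h \<cdot> a"] show ?thesis using assms by simp
qed

section \<open>Coordinates on the products of the groups of a simplicial group\<close>

lemma W_objs_Obj [simp]: "set (W_objs G n) \<subseteq> Obj C"
  by (auto simp: W_objs_def)

lemma W_space_Obj [simp]: "W_space C G n \<in> Obj C"
  by (simp add: W_space_def)

lemma W_el_arr [simp]:
  assumes "k \<le> n"
  shows "W_el C G n k \<in> Arr C" "Dom C (W_el C G n k) = W_space C G n"
    "Cod C (W_el C G n k) = car G k"
  using assms by (simp_all add: W_el_def W_space_def)

lemma W_eqI:
  assumes "h \<in> Arr C" "h' \<in> Arr C" "Dom C h = Dom C h'"
    "Cod C h = W_space C G n" "Cod C h' = W_space C G n"
    and "\<And>k. k \<le> n \<Longrightarrow> W_el C G n k \<cdot> h = W_el C G n k \<cdot> h'"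
  shows "h = h'"
proof (rule prod_eqI[where as = "W_objs G n"])
  fix k assume "k < length (W_objs G n)"
  then show "Proj C (W_objs G n) k \<cdot> h = Proj C (W_objs G n) k \<cdot> h'"
    using assms(6)[of "n - k"] by (simp add: W_el_def)
qed (use assms in \<open>auto simp: W_space_def\<close>)

lemma W_tuple_arr:
  assumes x: "x \<in> Obj C"
    and a: "\<And>k. k \<le> n \<Longrightarrow> a k \<in> Arr C \<and> Dom C (a k) = x \<and> Cod C (a k) = car G k"
  shows "W_tuple C x n a \<in> Arr C" "Dom C (W_tuple C x n a) = x"
    "Cod C (W_tuple C x n a) = W_space C G n"
    "k \<le> n \<Longrightarrow> W_el C G n k \<cdot> W_tuple C x n a = a k"
proof -
  have "\<forall>f \<in> set (map a (rev [0..<Suc n])). f \<in> Arr C \<and> Dom C f = x"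
    using a by (simp del: upt_Suc)
  note t = tuple_arr[OF x this, folded W_tuple_def]
  have c: "map (Cod C) (map a (rev [0..<Suc n])) = W_objs G n"
    using a by (simp add: W_objs_def del: upt_Suc)
  show "W_tuple C x n a \<in> Arr C" "Dom C (W_tuple C x n a) = x"
    "Cod C (W_tuple C x n a) = W_space C G n"
    using t(1-3) unfolding c W_space_def by auto
  show "W_el C G n k \<cdot> W_tuple C x n a = a k" if "k \<le> n"
    using t(4)[of "n - k"] that unfolding c by (simp add: W_el_def rev_nth del: upt_Suc)
qed

lemma W_el_W_tuple_comp:
  assumes x: "x \<in> Obj C"
    and a: "\<And>k. k \<le> n \<Longrightarrow> a k \<in> Arr C \<and> Dom C (a k) = x \<and> Cod C (a k) = car G k"
    and "k \<le> n" "h \<in> Arr C" "Cod C h = x"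
  shows "W_el C G n k \<cdot> (W_tuple C x n a \<cdot> h) = a k \<cdot> h"
  using assms(3-5) W_tuple_arr[OF x a]
  by (simp add: comp_assoc[symmetric] del: comp_assoc)

lemma Wgr_face_arr [simp]:
  assumes i: "i \<le> Suc n"
  shows "Wgr_face C G (Suc n) i \<in> Arr C" "Dom C (Wgr_face C G (Suc n) i) = W_space C G (Suc n)"
    "Cod C (Wgr_face C G (Suc n) i) = W_space C G n"
    "k \<le> n \<Longrightarrow> W_el C G n k \<cdot> Wgr_face C G (Suc n) i =
      (if n < i + k then gface G (Suc k) (i + k - n) \<cdot> W_el C G (Suc n) (Suc k)
       else W_el C G (Suc n) k)"
  unfolding Wgr_face_eq[OF i] by (rule W_tuple_arr; use i in simp)+

lemma W_el_Wgr_face_comp [simp]: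
  assumes "i \<le> Suc n" "k \<le> n" "h \<in> Arr C" "Cod C h = W_space C G (Suc n)"
  shows "W_el C G n k \<cdot> (Wgr_face C G (Suc n) i \<cdot> h) =
      (if n < i + k then gface G (Suc k) (i + k - n) \<cdot> (W_el C G (Suc n) (Suc k) \<cdot> h)
       else W_el C G (Suc n) k \<cdot> h)"
proof -
  have "W_el C G n k \<cdot> (Wgr_face C G (Suc n) i \<cdot> h) = (W_el C G n k \<cdot> Wgr_face C G (Suc n) i) \<cdot> h"
    using assms by (simp del: Wgr_face_arr(4))
  also have "\<dots> = (if n < i + k then gface G (Suc k) (i + k - n) \<cdot> (W_el C G (Suc n) (Suc k) \<cdot> h)
       else W_el C G (Suc n) k \<cdot> h)"
    using assms by simp
  finally show ?thesis .
qed

lemma Wgr_degen_arr [simp]: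
  assumes i: "i \<le> n"
  shows "Wgr_degen C G n i \<in> Arr C" "Dom C (Wgr_degen C G n i) = W_space C G n"
    "Cod C (Wgr_degen C G n i) = W_space C G (Suc n)"
    "k \<le> Suc n \<Longrightarrow> W_el C G (Suc n) k \<cdot> Wgr_degen C G n i =
      (if n < i + k then gdegen G (k - 1) (i + k - Suc n) \<cdot> W_el C G n (k - 1)
       else W_el C G n k)"
proof -
  have a: "(if n < i + k then gdegen G (k - 1) (i + k - Suc n) \<cdot> W_el C G n (k - 1)
      else W_el C G n k) \<in> Arr C \<and>
    Dom C (if n < i + k then gdegen G (k - 1) (i + k - Suc n) \<cdot> W_el C G n (k - 1)
      else W_el C G n k) = W_space C G n \<and>
    Cod C (if n < i + k then gdegen G (k - 1) (i + k - Suc n) \<cdot> W_el C G n (k - 1)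
      else W_el C G n k) = car G k" if "k \<le> Suc n" for k
    using i that by (cases k) auto
  show "Wgr_degen C G n i \<in> Arr C" "Dom C (Wgr_degen C G n i) = W_space C G n"
    "Cod C (Wgr_degen C G n i) = W_space C G (Suc n)"
    "k \<le> Suc n \<Longrightarrow> W_el C G (Suc n) k \<cdot> Wgr_degen C G n i =
      (if n < i + k then gdegen G (k - 1) (i + k - Suc n) \<cdot> W_el C G n (k - 1)
       else W_el C G n k)"
    unfolding Wgr_degen_eq[OF i] by (rule W_tuple_arr[OF W_space_Obj a]; assumption)+
qed

lemma W_el_Wgr_degen_comp [simp]:
  assumes "i \<le> n" "k \<le> Suc n" "h \<in> Arr C" "Cod C h = W_space C G n"
  shows "W_el C G (Suc n) k \<cdot> (Wgr_degen C G n i \<cdot> h) =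
      (if n < i + k then gdegen G (k - 1) (i + k - Suc n) \<cdot> (W_el C G n (k - 1) \<cdot> h)
       else W_el C G n k \<cdot> h)"
proof -
  have "W_el C G (Suc n) k \<cdot> (Wgr_degen C G n i \<cdot> h) = (W_el C G (Suc n) k \<cdot> Wgr_degen C G n i) \<cdot> h"
    using assms by (simp del: Wgr_degen_arr(4))
  also have "\<dots> = (if n < i + k then gdegen G (k - 1) (i + k - Suc n) \<cdot> (W_el C G n (k - 1) \<cdot> h)
       else W_el C G n k \<cdot> h)"
    using assms by (cases k) auto
  finally show ?thesis .
qed

section \<open>The componentwise group structure\<close>

lemma Wgr_group_arr [simp]:
  shows "gmult (Wgr_group C G n) \<in> Arr C"
    "Dom C (gmult (Wgr_group C G n)) = Prod C [W_space C G n, W_space C G n]"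
    "Cod C (gmult (Wgr_group C G n)) = W_space C G n"
    "gunit (Wgr_group C G n) \<in> Arr C" "Dom C (gunit (Wgr_group C G n)) = Prod C []"
    "Cod C (gunit (Wgr_group C G n)) = W_space C G n"
    "ginv (Wgr_group C G n) \<in> Arr C" "Dom C (ginv (Wgr_group C G n)) = W_space C G n"
    "Cod C (ginv (Wgr_group C G n)) = W_space C G n"
  unfolding Wgr_group_sel Let_def by (rule W_tuple_arr; simp)+

lemma Wgr_gmul:
  assumes "a \<in> Arr C" "b \<in> Arr C" "Dom C b = Dom C a"
    "Cod C a = W_space C G n" "Cod C b = W_space C G n"
  shows "gmul C (Wgr_group C G n) a b \<in> Arr C" "Dom C (gmul C (Wgr_group C G n) a b) = Dom C a"
    "Cod C (gmul C (Wgr_group C G n) a b) = W_space C G n"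
    "k \<le> n \<Longrightarrow> W_el C G n k \<cdot> gmul C (Wgr_group C G n) a b =
      gmul C (splx G k) (W_el C G n k \<cdot> a) (W_el C G n k \<cdot> b)"
proof -
  show "gmul C (Wgr_group C G n) a b \<in> Arr C" "Dom C (gmul C (Wgr_group C G n) a b) = Dom C a"
    "Cod C (gmul C (Wgr_group C G n) a b) = W_space C G n"
    using assms by (simp_all add: gmul_def)
  show "W_el C G n k \<cdot> gmul C (Wgr_group C G n) a b =
      gmul C (splx G k) (W_el C G n k \<cdot> a) (W_el C G n k \<cdot> b)" if "k \<le> n"
    unfolding gmul_def[of C "Wgr_group C G n"] Wgr_group_sel Let_def
    by (subst W_el_W_tuple_comp) (use assms that in simp_all)
qed

lemma Wgr_gone:
  assumes "x \<in> Obj C"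
  shows "gone C (Wgr_group C G n) x \<in> Arr C" "Dom C (gone C (Wgr_group C G n) x) = x"
    "Cod C (gone C (Wgr_group C G n) x) = W_space C G n"
    "k \<le> n \<Longrightarrow> W_el C G n k \<cdot> gone C (Wgr_group C G n) x = gone C (splx G k) x"
proof -
  show "gone C (Wgr_group C G n) x \<in> Arr C" "Dom C (gone C (Wgr_group C G n) x) = x"
    "Cod C (gone C (Wgr_group C G n) x) = W_space C G n"
    using assms by (simp_all add: gone_def)
  show "W_el C G n k \<cdot> gone C (Wgr_group C G n) x = gone C (splx G k) x" if "k \<le> n"
    unfolding gone_def Wgr_group_sel
    by (subst W_el_W_tuple_comp) (use assms that in simp_all)
qed

lemma Wgr_ginv:
  "k \<le> n \<Longrightarrow> W_el C G n k \<cdot> ginv (Wgr_group C G n) = ginv (splx G k) \<cdot> W_el C G n k"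
  unfolding Wgr_group_sel by (rule W_tuple_arr) simp_all

text \<open>Projection to entry \<open>k\<close> commutes with product, identity element and
  inverse, so each axiom reduces to the same axiom in the group of degree \<open>k\<close>.\<close>

lemma group_object_Wgr_group [simp]: "group_object C (Wgr_group C G n)"
proof -
  let ?K = "Wgr_group C G n" and ?w = "W_space C G n"
  let ?p = "Proj C [?w, ?w, ?w]" and ?e = "Idt C ?w"
  note [simp] = Wgr_gmul Wgr_gone Wgr_ginv
  have p [simp]: "?p j \<in> Arr C" "Dom C (?p j) = Prod C [?w, ?w, ?w]" "Cod C (?p j) = ?w"
    if "j = 0 \<or> j = Suc 0 \<or> j = 2" for j
    using that by auto
  have "gmul C ?K (gmul C ?K (?p 0) (?p (Suc 0))) (?p 2) = gmul C ?K (?p 0) (gmul C ?K (?p (Suc 0)) (?p 2))"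
    by (rule W_eqI[of _ _ n]) (simp_all add: gmul_assoc)
  moreover have "gmul C ?K (gone C ?K ?w) ?e = ?e" "gmul C ?K ?e (gone C ?K ?w) = ?e"
    "gmul C ?K (ginv ?K) ?e = gone C ?K ?w" "gmul C ?K ?e (ginv ?K) = gone C ?K ?w"
    by (rule W_eqI[of _ _ n]; simp add: gmul_unit_inv)+
  ultimately show ?thesis
    by (simp add: group_object_def Let_def hom_def)
qed

text \<open>Multiplication in the target is componentwise and the projections are jointly monic, so
  multiplicativity can be checked on each component.\<close>

lemma Wgr_group_homI:
  assumes K: "group_object C K" and f: "f \<in> Arr C" "Dom C f = gcar K" "Cod C f = W_space C G n"
    and hom: "\<And>k. k \<le> n \<Longrightarrow> group_hom C K (splx G k) (W_el C G n k \<cdot> f)"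
  shows "group_hom C K (Wgr_group C G n) f"
proof (rule group_homI)
  fix a b
  assume ab: "a \<in> Arr C" "Cod C a = gcar K" "b \<in> Arr C" "Cod C b = gcar K" "Dom C b = Dom C a"
  show "f \<cdot> gmul C K a b = gmul C (Wgr_group C G n) (f \<cdot> a) (f \<cdot> b)"
  proof (rule W_eqI[of _ _ n])
    fix k assume k: "k \<le> n"
    have "(W_el C G n k \<cdot> f) \<cdot> gmul C K a b =
        gmul C (splx G k) ((W_el C G n k \<cdot> f) \<cdot> a) ((W_el C G n k \<cdot> f) \<cdot> b)"
      using ab K by (intro group_hom_gmul[OF hom[OF k]]) auto
    then show "W_el C G n k \<cdot> (f \<cdot> gmul C K a b) =
        W_el C G n k \<cdot> gmul C (Wgr_group C G n) (f \<cdot> a) (f \<cdot> b)"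
      using ab K f k by (simp add: Wgr_gmul)
  qed (use ab K f in simp_all)
qed (use K f in simp_all)

lemma W_el_hom: "k \<le> n \<Longrightarrow> group_hom C (Wgr_group C G n) (splx G k) (W_el C G n k)"
  by (rule group_homI) (simp_all add: Wgr_gmul)

section \<open>Faces and degeneracies of Wgr\<close>

lemma Wgr_face_hom:
  assumes i: "i \<le> Suc n"
  shows "group_hom C (Wgr_group C G (Suc n)) (Wgr_group C G n) (Wgr_face C G (Suc n) i)"
proof (rule Wgr_group_homI)
  fix k assume "k \<le> n"
  then show "group_hom C (Wgr_group C G (Suc n)) (splx G k) (W_el C G n k \<cdot> Wgr_face C G (Suc n) i)"
    using i by (auto intro!: W_el_hom group_hom_comp[of _ "splx G (Suc k)"] gface_hom)
qed (use i in simp_all)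

lemma Wgr_degen_hom:
  assumes i: "i \<le> n"
  shows "group_hom C (Wgr_group C G n) (Wgr_group C G (Suc n)) (Wgr_degen C G n i)"
proof (rule Wgr_group_homI)
  fix k assume "k \<le> Suc n"
  then show "group_hom C (Wgr_group C G n) (splx G k) (W_el C G (Suc n) k \<cdot> Wgr_degen C G n i)"
    using i by (cases k) (auto intro!: W_el_hom group_hom_comp[of _ "splx G (k - 1)"] gdegen_hom)
qed (use i in simp_all)

text \<open>On entry \<open>k\<close> there are three possibilities: both faces act, which is the
  face identity of G with both indices shifted by \<open>n - k\<close>; only the face with the
  larger index acts, in the same way on both sides; or entry \<open>k\<close> is copied. The
  identities involving degeneracies split in a similar way.\<close>

lemma Wgr_face_face:
  assumes "i \<le> j" "j \<le> Suc n"
  shows "Wgr_face C G (Suc n) i \<cdot> Wgr_face C G (Suc (Suc n)) (Suc j) =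
    Wgr_face C G (Suc n) j \<cdot> Wgr_face C G (Suc (Suc n)) i"
proof (rule W_eqI[of _ _ n])
  fix k assume "k \<le> n"
  then show "W_el C G n k \<cdot> (Wgr_face C G (Suc n) i \<cdot> Wgr_face C G (Suc (Suc n)) (Suc j)) =
      W_el C G n k \<cdot> (Wgr_face C G (Suc n) j \<cdot> Wgr_face C G (Suc (Suc n)) i)"
    using assms by (auto simp: gface_gface Suc_diff_le)
qed (use assms in simp_all)

lemma Wgr_degen_degen:
  assumes "i \<le> j" "j \<le> n"
  shows "Wgr_degen C G (Suc n) i \<cdot> Wgr_degen C G n j = Wgr_degen C G (Suc n) (Suc j) \<cdot> Wgr_degen C G n i"
proof (rule W_eqI[of _ _ "Suc (Suc n)"])
  fix k assume "k \<le> Suc (Suc n)"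
  then show "W_el C G (Suc (Suc n)) k \<cdot> (Wgr_degen C G (Suc n) i \<cdot> Wgr_degen C G n j) =
      W_el C G (Suc (Suc n)) k \<cdot> (Wgr_degen C G (Suc n) (Suc j) \<cdot> Wgr_degen C G n i)"
    \<comment> \<open>When both degeneracies act, entry \<open>k\<close> comes from degree
      \<open>k - 2\<close>; the two case splits make these subtractions genuine
      predecessors.\<close>
    using assms by (cases k; cases "k - 1") (auto simp: gdegen_gdegen Suc_diff_le)
qed (use assms in simp_all)

lemma Wgr_face_degen_less:
  assumes "i \<le> j" "j \<le> n"
  shows "Wgr_face C G (Suc (Suc n)) i \<cdot> Wgr_degen C G (Suc n) (Suc j) =
    Wgr_degen C G n j \<cdot> Wgr_face C G (Suc n) i"
proof (rule W_eqI[of _ _ "Suc n"])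
  fix k assume "k \<le> Suc n"
  then show "W_el C G (Suc n) k \<cdot> (Wgr_face C G (Suc (Suc n)) i \<cdot> Wgr_degen C G (Suc n) (Suc j)) =
      W_el C G (Suc n) k \<cdot> (Wgr_degen C G n j \<cdot> Wgr_face C G (Suc n) i)"
    using assms by (cases k) (auto simp: gface_gdegen_less Suc_diff_le)
qed (use assms in simp_all)

lemma Wgr_face_degen_cancel:
  assumes "j \<le> n" "i = j \<or> i = Suc j"
  shows "Wgr_face C G (Suc n) i \<cdot> Wgr_degen C G n j = Idt C (W_space C G n)"
proof (rule W_eqI[of _ _ n])
  fix k assume "k \<le> n"
  then show "W_el C G n k \<cdot> (Wgr_face C G (Suc n) i \<cdot> Wgr_degen C G n j) =
      W_el C G n k \<cdot> Idt C (W_space C G n)"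
    using assms by (auto simp: gface_gdegen_cancel Suc_diff_le)
qed (use assms in auto)

lemma Wgr_face_degen_greater:
  assumes "j < i" "i \<le> Suc n"
  shows "Wgr_face C G (Suc (Suc n)) (Suc i) \<cdot> Wgr_degen C G (Suc n) j =
    Wgr_degen C G n j \<cdot> Wgr_face C G (Suc n) i"
proof (rule W_eqI[of _ _ "Suc n"])
  fix k assume "k \<le> Suc n"
  then show "W_el C G (Suc n) k \<cdot> (Wgr_face C G (Suc (Suc n)) (Suc i) \<cdot> Wgr_degen C G (Suc n) j) =
      W_el C G (Suc n) k \<cdot> (Wgr_degen C G n j \<cdot> Wgr_face C G (Suc n) i)"
    using assms by (cases k) (auto simp: gface_gdegen_greater Suc_diff_le)
qed (use assms in simp_all)

lemma simplicial_object_Wgr [simp]: "simplicial_object (Grp C) (Wgr_obj C G)"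
  unfolding Wgr_obj_def
  by (rule simplicial_object_mk_sobjI)
    (auto simp: hom_Grp_iff Wgr_face_hom Wgr_degen_hom Wgr_face_face Wgr_degen_degen
      Wgr_face_degen_less Wgr_face_degen_cancel Wgr_face_degen_greater)

end

end

section \<open>Comparison of \<open>W\<close> with \<open>Wgr\<close>\<close>

text \<open>\<open>theta_coord C G n m\<close> is the entry of \<open>\<theta>(g\<^sub>n, \<dots>, g\<^sub>0)\<close> in \<open>G\<^sub>n\<^sub>-\<^sub>m\<close>: the recursion
  runs downwards from \<open>G\<^sub>n\<close>.\<close>

primrec theta_coord :: "('o, 'm, 'z) fp_cat_scheme \<Rightarrow> ('o, 'm) sgrp \<Rightarrow> nat \<Rightarrow> nat \<Rightarrow> 'm" where
  "theta_coord C G n 0 = W_el C G n n"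
| "theta_coord C G n (Suc m) = gmul C (splx G (n - Suc m))
    (gface G (Suc (n - Suc m)) 0 \<cdot>\<^bsub>C\<^esub> theta_coord C G n m) (W_el C G n (n - Suc m))"

definition theta :: "('o, 'm, 'z) fp_cat_scheme \<Rightarrow> ('o, 'm) sgrp \<Rightarrow> nat \<Rightarrow> 'm" where
  "theta C G n = W_tuple C (W_space C G n) n (\<lambda>k. theta_coord C G n (n - k))"

definition theta_inv :: "('o, 'm, 'z) fp_cat_scheme \<Rightarrow> ('o, 'm) sgrp \<Rightarrow> nat \<Rightarrow> 'm" where
  "theta_inv C G n = W_tuple C (W_space C G n) n
    (\<lambda>k. if k < n
      then gmul C (splx G k)
        (ginv (splx G k) \<cdot>\<^bsub>C\<^esub> (gface G (Suc k) 0 \<cdot>\<^bsub>C\<^esub> W_el C G n (Suc k))) (W_el C G n k)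
      else W_el C G n k)"

context finite_product_category
begin

context
  fixes G :: "('o, 'm) sgrp"
  assumes G [simp]: "simplicial_object (Grp C) G"
begin

lemma W_face_arr [simp]:
  assumes i: "i \<le> Suc n"
  shows "W_face C G (Suc n) i \<in> Arr C" "Dom C (W_face C G (Suc n) i) = W_space C G (Suc n)"
    "Cod C (W_face C G (Suc n) i) = W_space C G n"
    "k \<le> n \<Longrightarrow> W_el C G n k \<cdot> W_face C G (Suc n) i =
      (if n < i + k then gface G (Suc k) (i + k - n) \<cdot> W_el C G (Suc n) (Suc k)
       else if n = i + k
       then gmul C (splx G k) (gface G (Suc k) 0 \<cdot> W_el C G (Suc n) (Suc k)) (W_el C G (Suc n) k)
       else W_el C G (Suc n) k)"
  unfolding W_face_eq[OF i] by (rule W_tuple_arr[OF G]; use i in simp)+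

lemma W_degen_arr [simp]:
  assumes i: "i \<le> n"
  shows "W_degen C G n i \<in> Arr C" "Dom C (W_degen C G n i) = W_space C G n"
    "Cod C (W_degen C G n i) = W_space C G (Suc n)"
    "k \<le> Suc n \<Longrightarrow> W_el C G (Suc n) k \<cdot> W_degen C G n i =
      (if n < i + k then gdegen G (k - 1) (i + k - Suc n) \<cdot> W_el C G n (k - 1)
       else if n = i + k then gone C (splx G k) (W_space C G n)
       else W_el C G n k)"
proof -
  let ?a = "\<lambda>k. if n < i + k then gdegen G (k - 1) (i + k - Suc n) \<cdot> W_el C G n (k - 1)
    else if n = i + k then gone C (splx G k) (W_space C G n) else W_el C G n k"
  have a: "?a k \<in> Arr C \<and> Dom C (?a k) = W_space C G n \<and> Cod C (?a k) = car G k"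
    if "k \<le> Suc n" for k
    using i that by (cases k) auto
  show "W_degen C G n i \<in> Arr C" "Dom C (W_degen C G n i) = W_space C G n"
    "Cod C (W_degen C G n i) = W_space C G (Suc n)"
    "k \<le> Suc n \<Longrightarrow> W_el C G (Suc n) k \<cdot> W_degen C G n i = ?a k"
    unfolding W_degen_eq[OF i] by (rule W_tuple_arr[OF G W_space_Obj[OF G] a]; assumption)+
qed

section \<open>The isomorphism \<theta> and its inverse\<close>

lemma theta_coord_arr:
  assumes "m \<le> n"
  shows "theta_coord C G n m \<in> Arr C \<and> Dom C (theta_coord C G n m) = W_space C G n \<and>
    Cod C (theta_coord C G n m) = car G (n - m)"
  using assms
proof (induction m)
  case (Suc m)
  \<comment> \<open>With this form \<open>n - Suc m\<close> evaluates to \<open>k\<close>, and the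
    zeroth face in the recursion starts in degree \<open>Suc k\<close>.\<close>
  then obtain k where "n = Suc (m + k)" by (auto dest: le_Suc_ex)
  then show ?case using Suc by simp
qed simp

lemma theta_arr [simp]:
  "theta C G n \<in> Arr C" "Dom C (theta C G n) = W_space C G n"
  "Cod C (theta C G n) = W_space C G n" "W_el C G n n \<cdot> theta C G n = W_el C G n n"
  using W_tuple_arr[OF G, of "W_space C G n" n "\<lambda>k. theta_coord C G n (n - k)"]
    theta_coord_arr[of "n - _" n]
  by (simp_all add: theta_def)

text \<open>The recursion on the distance from the top becomes a relation between the entries of
  degrees \<open>k\<close> and \<open>k + 1\<close>. Together with the top entry it is all that is
  used of \<open>theta\<close> from here on.\<close>

lemma W_el_theta:
  assumes k: "k < n"
  shows "W_el C G n k \<cdot> theta C G n =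
    gmul C (splx G k) (gface G (Suc k) 0 \<cdot> (W_el C G n (Suc k) \<cdot> theta C G n)) (W_el C G n k)"
proof -
  have el: "W_el C G n j \<cdot> theta C G n = theta_coord C G n (n - j)" if "j \<le> n" for j
    using W_tuple_arr(4)[OF G, of "W_space C G n" n "\<lambda>k. theta_coord C G n (n - k)" j]
      theta_coord_arr[of "n - _" n] that
    by (simp add: theta_def)
  have "n - k = Suc (n - Suc k)" using k by simp
  then show ?thesis using k by (simp add: el)
qed

lemma W_el_theta_comp [simp]:
  assumes "h \<in> Arr C" "Cod C h = W_space C G n"
  shows "W_el C G n n \<cdot> (theta C G n \<cdot> h) = W_el C G n n \<cdot> h"
proof -
  have "W_el C G n n \<cdot> (theta C G n \<cdot> h) = (W_el C G n n \<cdot> theta C G n) \<cdot> h"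
    using assms by (simp del: theta_arr(4))
  then show ?thesis by simp
qed

lemma W_el_theta_comp_less:
  assumes k: "k < n" and h: "h \<in> Arr C" "Cod C h = W_space C G n"
  shows "W_el C G n k \<cdot> (theta C G n \<cdot> h) =
    gmul C (splx G k) (gface G (Suc k) 0 \<cdot> (W_el C G n (Suc k) \<cdot> (theta C G n \<cdot> h)))
      (W_el C G n k \<cdot> h)"
  using arg_cong[OF W_el_theta[OF k], of "\<lambda>f. f \<cdot> h"] k h by simp

text \<open>The top entry and the relation between neighbours determine every entry, by induction
  downwards from \<open>n\<close>. Proving an arrow equal to \<open>theta\<close> after
  \<open>h\<close> thus requires only a check of neighbouring entries.\<close>

lemma theta_unique:
  assumes f: "f \<in> Arr C" "Cod C f = W_space C G n"
    and h: "h \<in> Arr C" "Cod C h = W_space C G n" "Dom C h = Dom C f"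
    and top: "W_el C G n n \<cdot> f = W_el C G n n \<cdot> h"
    and step: "\<And>k. k < n \<Longrightarrow> W_el C G n k \<cdot> f =
      gmul C (splx G k) (gface G (Suc k) 0 \<cdot> (W_el C G n (Suc k) \<cdot> f)) (W_el C G n k \<cdot> h)"
  shows "f = theta C G n \<cdot> h"
proof (rule W_eqI[OF G, of _ _ n])
  fix k assume "k \<le> n"
  then show "W_el C G n k \<cdot> f = W_el C G n k \<cdot> (theta C G n \<cdot> h)"
  proof (induction k rule: inc_induct)
    case base
    show ?case using h top by simp
  next
    case (step k)
    then show ?case using assms(7)[of k] h by (simp add: W_el_theta_comp_less[of k])
  qed
qed (use f h in simp_all)

lemma theta_inv_arr [simp]:
  "theta_inv C G n \<in> Arr C" "Dom C (theta_inv C G n) = W_space C G n"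
  "Cod C (theta_inv C G n) = W_space C G n"
  "k \<le> n \<Longrightarrow> W_el C G n k \<cdot> theta_inv C G n = (if k < n
    then gmul C (splx G k) (ginv (splx G k) \<cdot> (gface G (Suc k) 0 \<cdot> W_el C G n (Suc k))) (W_el C G n k)
    else W_el C G n k)"
  unfolding theta_inv_def by (rule W_tuple_arr[OF G]; simp)+

text \<open>The identity satisfies the recursion driven by \<open>theta_inv\<close>, since h_k =
  (d_0 h_(k+1)) ((d_0 h_(k+1))^-1 h_k); uniqueness gives the first equation. The second follows by
  substituting the recursion for h_k into the formula for the inverse.\<close>

lemma theta_inverse [simp]:
  "theta C G n \<cdot> theta_inv C G n = Idt C (W_space C G n)"
  "theta_inv C G n \<cdot> theta C G n = Idt C (W_space C G n)"
proof -
  show "theta C G n \<cdot> theta_inv C G n = Idt C (W_space C G n)"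
    by (rule theta_unique[symmetric]) (simp_all add: gmul_inv_cancel)
  show "theta_inv C G n \<cdot> theta C G n = Idt C (W_space C G n)"
  proof (rule W_eqI[OF G, of _ _ n])
    fix k assume k: "k \<le> n"
    have "W_el C G n k \<cdot> (theta_inv C G n \<cdot> theta C G n) =
        (W_el C G n k \<cdot> theta_inv C G n) \<cdot> theta C G n"
      using k by (simp del: theta_inv_arr(4))
    also have "\<dots> = W_el C G n k"
      using k by (auto simp: W_el_theta[of k] gmul_inv_cancel)
    finally show "W_el C G n k \<cdot> (theta_inv C G n \<cdot> theta C G n) =
        W_el C G n k \<cdot> Idt C (W_space C G n)"
      using k by simp
  qed simp_all
qed

lemma theta_cancel:
  assumes "a \<in> Arr C" "b \<in> Arr C" "Dom C a = Dom C b"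
    "Cod C a = W_space C G n" "Cod C b = W_space C G n" "theta C G n \<cdot> a = theta C G n \<cdot> b"
  shows "a = b"
proof -
  have "(theta_inv C G n \<cdot> theta C G n) \<cdot> a = (theta_inv C G n \<cdot> theta C G n) \<cdot> b"
    using assms(1-5) by (simp add: assms(6) del: theta_inverse)
  then show ?thesis using assms(1-5) by simp
qed

text \<open>The composite on the right is shown to satisfy the recursion driven by
  \<open>W_face\<close>. The cases record whether the faces of Wgr alter both of the entries
  \<open>k\<close> and \<open>k + 1\<close>, only the upper one, or neither.\<close>

lemma theta_face:
  assumes i: "i \<le> Suc n"
  shows "theta C G n \<cdot> W_face C G (Suc n) i = Wgr_face C G (Suc n) i \<cdot> theta C G (Suc n)"
proof (rule theta_unique[symmetric])
  show "W_el C G n n \<cdot> (Wgr_face C G (Suc n) i \<cdot> theta C G (Suc n)) = W_el C G n n \<cdot> W_face C G (Suc n) i"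
    \<comment> \<open>For \<open>i = 0\<close> the top entry after the face is h_n = (d_0 g_(n+1))
      g_n, the product formed by W. For positive \<open>i\<close> both sides apply d_i to
      g_(n+1).\<close>
    using i by (cases i) (auto simp: W_el_theta[of n "Suc n"])
  fix k assume k: "k < n"
  consider "n < i + k" | "n = i + k" | "i + k < n" by linarith
  then show "W_el C G n k \<cdot> (Wgr_face C G (Suc n) i \<cdot> theta C G (Suc n)) =
      gmul C (splx G k)
        (gface G (Suc k) 0 \<cdot> (W_el C G n (Suc k) \<cdot> (Wgr_face C G (Suc n) i \<cdot> theta C G (Suc n))))
        (W_el C G n k \<cdot> W_face C G (Suc n) i)"
  proof cases
    case 1
    then show ?thesis using i k
      by (simp add: W_el_theta[of "Suc k" "Suc n"] gface_gface[of G 0 "Suc (i + k - n)"] Suc_diff_le)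
  next
    case 2
    \<comment> \<open>The decisive case: h_k is unchanged while its upper neighbour becomes d_1
      h_(k+2). Expanding twice, h_k = (d_0 d_0 h_(k+2)) ((d_0 g_(k+1)) g_k), and d_0 d_0 = d_0
      d_1.\<close>
    then show ?thesis using i k
      by (simp add: W_el_theta[of k "Suc (i + k)"] W_el_theta[of "Suc k" "Suc (i + k)"] gmul_assoc
          gface_gface[of G 0 "Suc 0"])
  next
    case 3
    then show ?thesis using i k by (simp add: W_el_theta[of k "Suc n"])
  qed
qed (use i in simp_all)

text \<open>Where W inserts an identity element, Wgr has the neighbours s_0 h_k and h_k, and these
  satisfy the recursion with trivial factor because d_0 s_0 h_k = h_k. Above this place d_0 s_(j+1)
  = s_j d_0 applies, and below it nothing changes.\<close>

lemma theta_degen: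
  assumes i: "i \<le> n"
  shows "theta C G (Suc n) \<cdot> W_degen C G n i = Wgr_degen C G n i \<cdot> theta C G n"
proof (rule theta_unique[symmetric])
  fix k assume k: "k < Suc n"
  consider "n < i + k" | "n = i + k" | "i + k < n" by linarith
  then show "W_el C G (Suc n) k \<cdot> (Wgr_degen C G n i \<cdot> theta C G n) =
      gmul C (splx G k)
        (gface G (Suc k) 0 \<cdot> (W_el C G (Suc n) (Suc k) \<cdot> (Wgr_degen C G n i \<cdot> theta C G n)))
        (W_el C G (Suc n) k \<cdot> W_degen C G n i)"
  proof cases
    case 1
    then obtain l where l: "k = Suc l" using i by (cases k) auto
    show ?thesis using 1 i k
      by (simp add: l W_el_theta[of l n] gface_gdegen_less[of G 0 "Suc (i + l - n)"] Suc_diff_le)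
  next
    case 2
    then show ?thesis using i k by (simp add: gface_gdegen_cancel gmul_unit_inv)
  next
    case 3
    then show ?thesis using i k by (simp add: W_el_theta[of k n])
  qed
qed (use i in simp_all)

lemma theta_face_comp:
  assumes "i \<le> Suc n" "h \<in> Arr C" "Cod C h = W_space C G (Suc n)"
  shows "theta C G n \<cdot> (W_face C G (Suc n) i \<cdot> h) =
    Wgr_face C G (Suc n) i \<cdot> (theta C G (Suc n) \<cdot> h)"
  using arg_cong[OF theta_face[OF assms(1)], of "\<lambda>f. f \<cdot> h"] assms by simp

lemma theta_degen_comp:
  assumes "i \<le> n" "h \<in> Arr C" "Cod C h = W_space C G n"
  shows "theta C G (Suc n) \<cdot> (W_degen C G n i \<cdot> h) = Wgr_degen C G n i \<cdot> (theta C G n \<cdot> h)"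
  using arg_cong[OF theta_degen[OF assms(1)], of "\<lambda>f. f \<cdot> h"] assms by simp

text \<open>The simplicial identities of \<open>W\<close> are transported from \<open>Wgr\<close> along the isomorphisms \<open>\<theta>\<close>.\<close>

lemma simplicial_object_W [simp]: "simplicial_object C (W_obj C G)"
  unfolding W_obj_def
proof (rule simplicial_object_mk_sobjI)
  \<comment> \<open>These rules carry \<open>theta\<close> rightwards past the structure maps of W,
    turning them into those of Wgr. Each goal becomes a known identity of Wgr followed on the right
    by \<open>theta\<close>.\<close>
  note th = theta_face theta_face_comp theta_degen theta_degen_comp
  fix n i j :: nat
  show "W_space C G n \<in> Obj C" by simp
  show "W_face C G (Suc n) i \<in> hom C (W_space C G (Suc n)) (W_space C G n)" if "i \<le> Suc n"
    using that by (simp add: hom_def)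
  show "W_degen C G n i \<in> hom C (W_space C G n) (W_space C G (Suc n))" if "i \<le> n"
    using that by (simp add: hom_def)
  show "W_face C G (Suc n) i \<cdot> W_face C G (Suc (Suc n)) (Suc j) =
      W_face C G (Suc n) j \<cdot> W_face C G (Suc (Suc n)) i" if "i \<le> j" "j \<le> Suc n"
    using that arg_cong[OF Wgr_face_face[OF G that], of "\<lambda>h. h \<cdot> theta C G (Suc (Suc n))"]
    by - (rule theta_cancel[of _ _ n]; simp add: th)
  show "W_degen C G (Suc n) i \<cdot> W_degen C G n j = W_degen C G (Suc n) (Suc j) \<cdot> W_degen C G n i"
    if "i \<le> j" "j \<le> n"
    using that arg_cong[OF Wgr_degen_degen[OF G that], of "\<lambda>h. h \<cdot> theta C G n"]
    by - (rule theta_cancel[of _ _ "Suc (Suc n)"]; simp add: th)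
  show "W_face C G (Suc (Suc n)) i \<cdot> W_degen C G (Suc n) (Suc j) =
      W_degen C G n j \<cdot> W_face C G (Suc n) i" if "i \<le> j" "j \<le> n"
    using that arg_cong[OF Wgr_face_degen_less[OF G that], of "\<lambda>h. h \<cdot> theta C G (Suc n)"]
    by - (rule theta_cancel[of _ _ "Suc n"]; simp add: th)
  show "W_face C G (Suc n) j \<cdot> W_degen C G n j = Idt C (W_space C G n)" if "j \<le> n"
    using that arg_cong[OF Wgr_face_degen_cancel[OF G that, of j], of "\<lambda>h. h \<cdot> theta C G n"]
    by - (rule theta_cancel[of _ _ n]; simp add: th)
  show "W_face C G (Suc n) (Suc j) \<cdot> W_degen C G n j = Idt C (W_space C G n)" if "j \<le> n"
    using that arg_cong[OF Wgr_face_degen_cancel[OF G that, of "Suc j"], of "\<lambda>h. h \<cdot> theta C G n"]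
    by - (rule theta_cancel[of _ _ n]; simp add: th)
  show "W_face C G (Suc (Suc n)) (Suc i) \<cdot> W_degen C G (Suc n) j =
      W_degen C G n j \<cdot> W_face C G (Suc n) i" if "j < i" "i \<le> Suc n"
    using that arg_cong[OF Wgr_face_degen_greater[OF G that], of "\<lambda>h. h \<cdot> theta C G (Suc n)"]
    by - (rule theta_cancel[of _ _ "Suc n"]; simp add: th)
qed

end

end

section \<open>Functoriality\<close>

text \<open>The inverses in the individual degrees automatically commute with faces and
  degeneracies, so no simplicial property of \<open>g\<close> has to be supplied.\<close>

lemma (in category) iso_arrow_SimpI:
  assumes X: "simplicial_object C X" and Y: "simplicial_object C Y"
    and f: "simplicial_map C X Y f"
    and g: "\<And>n. g n \<in> hom C (splx Y n) (splx X n)"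
    and gf: "\<And>n. g n \<cdot> f n = Idt C (splx X n)" and fg: "\<And>n. f n \<cdot> g n = Idt C (splx Y n)"
  shows "iso_arrow (Simp C) (HArr X Y f)"
proof -
  have fh: "f n \<in> hom C (splx X n) (splx Y n)" for n
    using f by (simp add: simplicial_map_def)
  note [simp] = X Y homD[OF fh] homD[OF g] gf fg
  have transfer: "g m \<cdot> y = x \<cdot> g n"
    if x: "x \<in> Arr C" "Dom C x = splx X n" "Cod C x = splx X m"
      and y: "y \<in> Arr C" "Dom C y = splx Y n" "Cod C y = splx Y m"
      and xy: "f m \<cdot> x = y \<cdot> f n" for m n x y
  proof -
    \<comment> \<open>The commuting square for \<open>f\<close> is enclosed between the two
      inverses; cancelling on either side leaves the square for \<open>g\<close>.\<close>
    have "g m \<cdot> (f m \<cdot> x) \<cdot> g n = g m \<cdot> (y \<cdot> f n) \<cdot> g n" by (simp only: xy)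
    then have "(g m \<cdot> f m) \<cdot> (x \<cdot> g n) = g m \<cdot> (y \<cdot> (f n \<cdot> g n))"
      using x y by (simp del: gf fg)
    then show ?thesis using x y by simp
  qed
  have "simplicial_map C Y X g"
    unfolding simplicial_map_iff
  proof (intro conjI allI impI)
    show "g n \<cdot> face Y (Suc n) i = face X (Suc n) i \<cdot> g (Suc n)" if "i \<le> Suc n" for n i
      using that f by (intro transfer) (simp_all add: simplicial_map_iff)
    show "g (Suc n) \<cdot> degen Y n i = degen X n i \<cdot> g n" if "i \<le> n" for n i
      using that f by (intro transfer) (simp_all add: simplicial_map_iff)
  qed (rule g)
  then have "HArr Y X g \<in> hom (Simp C) Y X" by (simp add: hom_Simp_iff)
  then show ?thesis
    using f by (auto simp: iso_arrow_def intro!: bexI[of _ "HArr Y X g"])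
qed

context finite_product_category
begin

section \<open>Arrows between simplicial groups\<close>

lemma sGrp_homI:
  assumes G: "simplicial_object (Grp C) G" and H: "simplicial_object (Grp C) H"
    and f: "\<And>n. group_hom C (splx G n) (splx H n) (f n)"
    and face: "\<And>n i. i \<le> Suc n \<Longrightarrow> f n \<cdot> gface G (Suc n) i = gface H (Suc n) i \<cdot> f (Suc n)"
    and degen: "\<And>n i. i \<le> n \<Longrightarrow> f (Suc n) \<cdot> gdegen G n i = gdegen H n i \<cdot> f n"
  shows "HArr G H (\<lambda>n. HArr (splx G n) (splx H n) (f n)) \<in> hom (sGrp C) G H"
proof -
  have "hsrc (face G (Suc n) i) = splx G (Suc n)" "htgt (face H (Suc n) i) = splx H n"
    if "i \<le> Suc n" for n i
    using simplicial_objectD(2)[OF G that] simplicial_objectD(2)[OF H that]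
    by (auto simp: hom_Grp_iff)
  moreover have "hsrc (degen G n i) = splx G n" "htgt (degen H n i) = splx H (Suc n)"
    if "i \<le> n" for n i
    using simplicial_objectD(3)[OF G that] simplicial_objectD(3)[OF H that]
    by (auto simp: hom_Grp_iff)
  ultimately show ?thesis
    using assms by (simp add: hom_Simp_iff simplicial_map_iff hom_Grp_iff)
qed

lemma sGrp_homD:
  assumes F: "F \<in> hom (sGrp C) G H"
  shows "simplicial_object (Grp C) G" "simplicial_object (Grp C) H" "hsrc F = G" "htgt F = H"
    "group_hom C (splx G n) (splx H n) (hmap (hmap F n))"
    "i \<le> Suc n \<Longrightarrow>
      hmap (hmap F n) \<cdot> gface G (Suc n) i = gface H (Suc n) i \<cdot> hmap (hmap F (Suc n))"
    "i \<le> n \<Longrightarrow>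
      hmap (hmap F (Suc n)) \<cdot> gdegen G n i = gdegen H n i \<cdot> hmap (hmap F n)"
proof -
  have m: "simplicial_map (Grp C) G H (hmap F)" using F by (simp add: hom_Simp_iff)
  show "simplicial_object (Grp C) G" "simplicial_object (Grp C) H" "hsrc F = G" "htgt F = H"
    using F by (auto simp: hom_Simp_iff)
  show "group_hom C (splx G n) (splx H n) (hmap (hmap F n))"
    using m by (auto simp: simplicial_map_iff hom_Grp_iff)
  show "hmap (hmap F n) \<cdot> gface G (Suc n) i = gface H (Suc n) i \<cdot> hmap (hmap F (Suc n))"
    if "i \<le> Suc n"
  proof -
    have "hmap F n \<cdot>\<^bsub>Grp C\<^esub> face G (Suc n) i = face H (Suc n) i \<cdot>\<^bsub>Grp C\<^esub> hmap F (Suc n)"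
      using m that unfolding simplicial_map_iff by blast
    from arg_cong[OF this, of hmap] show ?thesis by simp
  qed
  show "hmap (hmap F (Suc n)) \<cdot> gdegen G n i = gdegen H n i \<cdot> hmap (hmap F n)" if "i \<le> n"
  proof -
    have "hmap F (Suc n) \<cdot>\<^bsub>Grp C\<^esub> degen G n i = degen H n i \<cdot>\<^bsub>Grp C\<^esub> hmap F n"
      using m that unfolding simplicial_map_iff by blast
    from arg_cong[OF this, of hmap] show ?thesis by simp
  qed
qed

text \<open>Sources and targets in every degree are fixed by \<open>G\<close> and \<open>H\<close>,
  so an arrow is determined by its underlying arrows in \<open>C\<close>. This reduces the monad
  equations to equations in \<open>C\<close>.\<close>

lemma sGrp_arr_eqI:
  assumes F: "F \<in> hom (sGrp C) G H" and F': "F' \<in> hom (sGrp C) G H"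
    and eq: "\<And>n. hmap (hmap F n) = hmap (hmap F' n)"
  shows "F = F'"
proof -
  have "hmap F n = hmap F' n" for n
  proof -
    have "hmap F n \<in> hom (Grp C) (splx G n) (splx H n)" "hmap F' n \<in> hom (Grp C) (splx G n) (splx H n)"
      using F F' by (auto simp: hom_Simp_iff simplicial_map_iff)
    then show ?thesis using eq[of n] by (auto simp: hom_Grp_iff intro: harr.expand)
  qed
  then show ?thesis using F F' by (auto simp: hom_Simp_iff intro!: harr.expand)
qed

lemma category_sGrp: "category (sGrp C)"
  using category_Grp by (rule category.category_Simp)

context
  fixes F :: "('o, 'm) sgrp_arr" and G H :: "('o, 'm) sgrp"
  assumes F: "F \<in> hom (sGrp C) G H"
begin

lemma sGrp_hom_objs [simp]:
  shows "simplicial_object (Grp C) G" "simplicial_object (Grp C) H" "hsrc F = G" "htgt F = H"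
  by (rule sGrp_homD[OF F])+

lemma hmap_hmap_arr [simp]:
  shows "hmap (hmap F n) \<in> Arr C" "Dom C (hmap (hmap F n)) = car G n"
    "Cod C (hmap (hmap F n)) = car H n"
  by (rule group_hom_arr[OF sGrp_homD(5)[OF F]])+

lemma hmap_gmul [simp]:
  assumes "a \<in> Arr C" "Cod C a = car G n" "b \<in> Arr C" "Cod C b = car G n" "Dom C b = Dom C a"
  shows "hmap (hmap F n) \<cdot> gmul C (splx G n) a b =
    gmul C (splx H n) (hmap (hmap F n) \<cdot> a) (hmap (hmap F n) \<cdot> b)"
  using assms by (intro group_hom_gmul[OF sGrp_homD(5)[OF F]]) auto

lemma hmap_gface [simp]:
  assumes "i \<le> Suc n" "a \<in> Arr C" "Cod C a = car G (Suc n)"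
  shows "hmap (hmap F n) \<cdot> (gface G (Suc n) i \<cdot> a) =
    gface H (Suc n) i \<cdot> (hmap (hmap F (Suc n)) \<cdot> a)"
  using arg_cong[OF sGrp_homD(6)[OF F assms(1)], of "\<lambda>f. f \<cdot> a"] assms by simp

lemma hmap_gdegen [simp]:
  assumes "i \<le> n" "a \<in> Arr C" "Cod C a = car G n"
  shows "hmap (hmap F (Suc n)) \<cdot> (gdegen G n i \<cdot> a) =
    gdegen H n i \<cdot> (hmap (hmap F n) \<cdot> a)"
  using arg_cong[OF sGrp_homD(7)[OF F assms(1)], of "\<lambda>f. f \<cdot> a"] assms by simp

section \<open>The induced maps of products\<close>

lemma W_map_arr [simp]:
  "W_map C F n \<in> Arr C" "Dom C (W_map C F n) = W_space C G n"
  "Cod C (W_map C F n) = W_space C H n"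
  "k \<le> n \<Longrightarrow> W_el C H n k \<cdot> W_map C F n = hmap (hmap F k) \<cdot> W_el C G n k"
  unfolding W_map_eq sGrp_hom_objs by (rule W_tuple_arr; simp)+

lemma W_el_W_map_comp [simp]:
  assumes "k \<le> n" "h \<in> Arr C" "Cod C h = W_space C G n"
  shows "W_el C H n k \<cdot> (W_map C F n \<cdot> h) = hmap (hmap F k) \<cdot> (W_el C G n k \<cdot> h)"
  using arg_cong[OF W_map_arr(4)[OF assms(1)], of "\<lambda>f. f \<cdot> h"] assms
  by (simp del: W_map_arr(4))

lemma W_map_hom: "group_hom C (Wgr_group C G n) (Wgr_group C H n) (W_map C F n)"
proof (rule Wgr_group_homI)
  fix k assume "k \<le> n"
  then show "group_hom C (Wgr_group C G n) (splx H k) (W_el C H n k \<cdot> W_map C F n)"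
    by (auto intro!: group_hom_comp[of _ "splx G k"] W_el_hom sGrp_homD(5)[OF F])
qed simp_all

lemma W_map_Wgr_face:
  assumes "i \<le> Suc n"
  shows "W_map C F n \<cdot> Wgr_face C G (Suc n) i = Wgr_face C H (Suc n) i \<cdot> W_map C F (Suc n)"
proof (rule W_eqI[of H _ _ n])
  fix k assume "k \<le> n"
  then show "W_el C H n k \<cdot> (W_map C F n \<cdot> Wgr_face C G (Suc n) i) =
      W_el C H n k \<cdot> (Wgr_face C H (Suc n) i \<cdot> W_map C F (Suc n))"
    using assms by auto
qed (use assms in simp_all)

lemma W_map_Wgr_degen:
  assumes "i \<le> n"
  shows "W_map C F (Suc n) \<cdot> Wgr_degen C G n i = Wgr_degen C H n i \<cdot> W_map C F n"
proof (rule W_eqI[of H _ _ "Suc n"])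
  fix k assume "k \<le> Suc n"
  then show "W_el C H (Suc n) k \<cdot> (W_map C F (Suc n) \<cdot> Wgr_degen C G n i) =
      W_el C H (Suc n) k \<cdot> (Wgr_degen C H n i \<cdot> W_map C F n)"
    using assms by (cases k) auto
qed (use assms in simp_all)

text \<open>Homomorphisms commute with d_0 and with multiplication, so the left side satisfies the
  recursion that defines \<open>theta\<close> for \<open>H\<close>.\<close>

lemma W_map_theta: "W_map C F n \<cdot> theta C G n = theta C H n \<cdot> W_map C F n"
proof (rule theta_unique)
  fix k assume "k < n"
  then show "W_el C H n k \<cdot> (W_map C F n \<cdot> theta C G n) =
      gmul C (splx H k) (gface H (Suc k) 0 \<cdot> (W_el C H n (Suc k) \<cdot> (W_map C F n \<cdot> theta C G n)))
        (W_el C H n k \<cdot> W_map C F n)"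
    by (simp add: W_el_theta[of G k n])
qed simp_all

text \<open>After composition with the monic \<open>theta\<close>, the claim turns into the
  corresponding square for Wgr, which holds entry by entry.\<close>

lemma W_map_W_face:
  assumes i: "i \<le> Suc n"
  shows "W_map C F n \<cdot> W_face C G (Suc n) i = W_face C H (Suc n) i \<cdot> W_map C F (Suc n)"
proof (rule theta_cancel[of H _ _ n])
  have "theta C H n \<cdot> (W_map C F n \<cdot> W_face C G (Suc n) i) =
      (W_map C F n \<cdot> theta C G n) \<cdot> W_face C G (Suc n) i"
    using i by (simp add: W_map_theta del: comp_assoc) (simp)
  also have "\<dots> = (W_map C F n \<cdot> Wgr_face C G (Suc n) i) \<cdot> theta C G (Suc n)"
    using i by (simp add: theta_face)
  also have "\<dots> = Wgr_face C H (Suc n) i \<cdot> (W_map C F (Suc n) \<cdot> theta C G (Suc n))"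
    using i by (simp add: W_map_Wgr_face del: comp_assoc) simp
  also have "\<dots> = theta C H n \<cdot> (W_face C H (Suc n) i \<cdot> W_map C F (Suc n))"
    using i by (simp add: W_map_theta theta_face_comp)
  finally show "theta C H n \<cdot> (W_map C F n \<cdot> W_face C G (Suc n) i) =
      theta C H n \<cdot> (W_face C H (Suc n) i \<cdot> W_map C F (Suc n))" .
qed (use i in simp_all)

lemma W_map_W_degen:
  assumes i: "i \<le> n"
  shows "W_map C F (Suc n) \<cdot> W_degen C G n i = W_degen C H n i \<cdot> W_map C F n"
proof (rule theta_cancel[of H _ _ "Suc n"])
  have "theta C H (Suc n) \<cdot> (W_map C F (Suc n) \<cdot> W_degen C G n i) =
      (W_map C F (Suc n) \<cdot> theta C G (Suc n)) \<cdot> W_degen C G n i"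
    using i by (simp add: W_map_theta del: comp_assoc) (simp)
  also have "\<dots> = (W_map C F (Suc n) \<cdot> Wgr_degen C G n i) \<cdot> theta C G n"
    using i by (simp add: theta_degen)
  also have "\<dots> = Wgr_degen C H n i \<cdot> (W_map C F n \<cdot> theta C G n)"
    using i by (simp add: W_map_Wgr_degen del: comp_assoc) simp
  also have "\<dots> = theta C H (Suc n) \<cdot> (W_degen C H n i \<cdot> W_map C F n)"
    using i by (simp add: W_map_theta theta_degen_comp)
  finally show "theta C H (Suc n) \<cdot> (W_map C F (Suc n) \<cdot> W_degen C G n i) =
      theta C H (Suc n) \<cdot> (W_degen C H n i \<cdot> W_map C F n)" .
qed (use i in simp_all)

lemma simplicial_map_W: "simplicial_map C (W_obj C G) (W_obj C H) (W_map C F)"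
  by (simp add: simplicial_map_iff W_obj_def hom_def W_map_W_face W_map_W_degen)

end

declare sGrp_hom_objs [simp del] hmap_hmap_arr [simp del] hmap_gmul [simp del]
  hmap_gface [simp del] hmap_gdegen [simp del] W_map_arr [simp del] W_el_W_map_comp [simp del]

lemma splx_Wgr_obj [simp]: "splx (Wgr_obj C G) n = Wgr_group C G n"
  by (simp add: Wgr_obj_def)

lemma gface_Wgr_obj [simp]: "i \<le> Suc n \<Longrightarrow> gface (Wgr_obj C G) (Suc n) i = Wgr_face C G (Suc n) i"
  by (simp add: Wgr_obj_def)

lemma gdegen_Wgr_obj [simp]: "i \<le> n \<Longrightarrow> gdegen (Wgr_obj C G) n i = Wgr_degen C G n i"
  by (simp add: Wgr_obj_def)

lemma W_map_idt:
  assumes G: "simplicial_object (Grp C) G"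
  shows "W_map C (Idt (sGrp C) G) n = Idt C (W_space C G n)"
proof -
  have I: "Idt (sGrp C) G \<in> hom (sGrp C) G G"
    by (rule category.Idt_hom[OF category_sGrp]) (simp add: G)
  note [simp] = G W_map_arr[OF I]
  show ?thesis
  proof (rule W_eqI[OF G, of _ _ n])
    fix k assume "k \<le> n"
    then show "W_el C G n k \<cdot> W_map C (Idt (sGrp C) G) n = W_el C G n k \<cdot> Idt C (W_space C G n)"
      by (simp del: Simp_sel) simp
  qed (simp_all del: Simp_sel)
qed

lemma W_map_comp:
  assumes F: "F \<in> hom (sGrp C) G H" and F': "F' \<in> hom (sGrp C) H K"
  shows "W_map C (F' \<cdot>\<^bsub>sGrp C\<^esub> F) n = W_map C F' n \<cdot> W_map C F n"
proof -
  have FF: "F' \<cdot>\<^bsub>sGrp C\<^esub> F \<in> hom (sGrp C) G K"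
    using category.Comp_hom[OF category_sGrp F F'] .
  note [simp] = sGrp_hom_objs[OF F] sGrp_hom_objs[OF F'] hmap_hmap_arr[OF F] hmap_hmap_arr[OF F']
    W_map_arr[OF F] W_map_arr[OF F'] W_map_arr[OF FF] W_el_W_map_comp[OF F']
  show ?thesis
  proof (rule W_eqI[of K _ _ n])
    fix k assume "k \<le> n"
    then show "W_el C K n k \<cdot> W_map C (F' \<cdot>\<^bsub>sGrp C\<^esub> F) n = W_el C K n k \<cdot> (W_map C F' n \<cdot> W_map C F n)"
      by (simp del: Simp_sel) simp
  qed (simp_all del: Simp_sel)
qed

section \<open>Functoriality of W and Wgr\<close>

lemma cat_functor_W: "cat_functor (sGrp C) (Simp C) (W_functor C)"
proof -
  interpret S: category "sGrp C" by (rule category_sGrp)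
  interpret T: category "Simp C" by (rule category_Simp)
  show ?thesis
  proof
    fix x y z f g
    show "x \<in> Obj (sGrp C) \<Longrightarrow> fobj (W_functor C) x \<in> Obj (Simp C)"
      by (simp add: W_functor_def)
    show "f \<in> hom (sGrp C) x y \<Longrightarrow>
        farr (W_functor C) f \<in> hom (Simp C) (fobj (W_functor C) x) (fobj (W_functor C) y)"
      using sGrp_hom_objs[of f x y] simplicial_map_W[of f x y]
      by (simp add: W_functor_def hom_Simp_iff[of _ C])
    show "x \<in> Obj (sGrp C) \<Longrightarrow>
        farr (W_functor C) (Idt (sGrp C) x) = Idt (Simp C) (fobj (W_functor C) x)"
      using W_map_idt[of x] by (simp add: W_functor_def W_obj_def fun_eq_iff)
    show "farr (W_functor C) (g \<cdot>\<^bsub>sGrp C\<^esub> f) = farr (W_functor C) g \<cdot>\<^bsub>Simp C\<^esub> farr (W_functor C) f"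
      if "f \<in> hom (sGrp C) x y" "g \<in> hom (sGrp C) y z"
      using W_map_comp[OF that] by (simp add: W_functor_def fun_eq_iff)
  qed
qed

lemma Wgr_functor_hom:
  assumes F: "F \<in> hom (sGrp C) G H"
  shows "farr (Wgr_functor C) F \<in> hom (sGrp C) (Wgr_obj C G) (Wgr_obj C H)"
  using sGrp_homI[of "Wgr_obj C G" "Wgr_obj C H" "W_map C F"] sGrp_hom_objs[OF F]
    W_map_hom[OF F] W_map_Wgr_face[OF F] W_map_Wgr_degen[OF F]
  by (simp add: Wgr_functor_def)

lemma cat_functor_Wgr: "cat_functor (sGrp C) (sGrp C) (Wgr_functor C)"
proof -
  interpret S: category "sGrp C" by (rule category_sGrp)
  show ?thesis
  proof
    fix x y z f g
    show "x \<in> Obj (sGrp C) \<Longrightarrow> fobj (Wgr_functor C) x \<in> Obj (sGrp C)"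
      by (simp add: Wgr_functor_def)
    show "f \<in> hom (sGrp C) x y \<Longrightarrow>
        farr (Wgr_functor C) f \<in> hom (sGrp C) (fobj (Wgr_functor C) x) (fobj (Wgr_functor C) y)"
      using Wgr_functor_hom[of f x y] by (simp add: Wgr_functor_def)
    show "x \<in> Obj (sGrp C) \<Longrightarrow>
        farr (Wgr_functor C) (Idt (sGrp C) x) = Idt (sGrp C) (fobj (Wgr_functor C) x)"
      using W_map_idt[of x] by (simp add: Wgr_functor_def fun_eq_iff)
    show "farr (Wgr_functor C) (g \<cdot>\<^bsub>sGrp C\<^esub> f) = farr (Wgr_functor C) g \<cdot>\<^bsub>sGrp C\<^esub> farr (Wgr_functor C) f"
      if "f \<in> hom (sGrp C) x y" "g \<in> hom (sGrp C) y z"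
      using W_map_comp[OF that] by (simp add: Wgr_functor_def fun_eq_iff)
  qed
qed

section \<open>The natural isomorphism\<close>

lemma simplicial_object_forget_Wgr:
  "simplicial_object (Grp C) G \<Longrightarrow> simplicial_object C (simp_ftr_obj forget_Grp (Wgr_obj C G))"
  using cat_functor.fobj_Obj[OF cat_functor_forget_sGrp, of "Wgr_obj C G"]
  by (simp add: forget_sGrp_def simp_ftr_def)

lemma forget_Wgr_sel [simp]:
  "splx (simp_ftr_obj forget_Grp (Wgr_obj C G)) n = W_space C G n"
  "i \<le> Suc n \<Longrightarrow> face (simp_ftr_obj forget_Grp (Wgr_obj C G)) (Suc n) i = Wgr_face C G (Suc n) i"
  "i \<le> n \<Longrightarrow> degen (simp_ftr_obj forget_Grp (Wgr_obj C G)) n i = Wgr_degen C G n i"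
  by (simp_all add: simp_ftr_obj_def forget_Grp_def)

lemma W_iso_forget_Wgr:
  "naturally_isomorphic (sGrp C) (Simp C) (W_functor C) (ftr_comp forget_sGrp (Wgr_functor C))"
proof -
  let ?U = "\<lambda>G. simp_ftr_obj forget_Grp (Wgr_obj C G)"
  let ?t = "\<lambda>G. HArr (W_obj C G) (?U G) (theta C G)"
  have map: "simplicial_map C (W_obj C G) (?U G) (theta C G)" if "simplicial_object (Grp C) G" for G
    using that by (simp add: simplicial_map_iff W_obj_def hom_def theta_face theta_degen)
  have "natural_isomorphism (sGrp C) (Simp C) (W_functor C) (ftr_comp forget_sGrp (Wgr_functor C)) ?t"
  proof (intro natural_isomorphism.intro natural_transformation.intro
      natural_transformation_axioms.intro natural_isomorphism_axioms.intro)
    fix G H F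
    show "cat_functor (sGrp C) (Simp C) (W_functor C)" by (rule cat_functor_W)
    show "cat_functor (sGrp C) (Simp C) (ftr_comp forget_sGrp (Wgr_functor C))"
      by (rule cat_functor_comp[OF cat_functor_Wgr cat_functor_forget_sGrp])
    show "?t G \<in> hom (Simp C) (fobj (W_functor C) G) (fobj (ftr_comp forget_sGrp (Wgr_functor C)) G)"
      if "G \<in> Obj (sGrp C)"
      using that map[of G] simplicial_object_forget_Wgr[of G]
      by (simp add: hom_Simp_iff W_functor_def Wgr_functor_def ftr_comp_def forget_sGrp_def simp_ftr_def)
    show "?t H \<cdot>\<^bsub>Simp C\<^esub> farr (W_functor C) F =
        farr (ftr_comp forget_sGrp (Wgr_functor C)) F \<cdot>\<^bsub>Simp C\<^esub> ?t G"
      if "F \<in> hom (sGrp C) G H"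
      using W_map_theta[OF that] sGrp_hom_objs[OF that]
      by (simp add: W_functor_def Wgr_functor_def ftr_comp_def forget_sGrp_def simp_ftr_def
          forget_Grp_def)
    show "iso_arrow (Simp C) (?t G)" if "G \<in> Obj (sGrp C)"
      using that map[of G] simplicial_object_forget_Wgr[of G] simplicial_object_W[of G]
      by (intro iso_arrow_SimpI[where g = "theta_inv C G"]) (simp_all add: W_obj_def hom_def)
  qed
  then show ?thesis by (auto simp: naturally_isomorphic_def)
qed

end

section \<open>The monad structure\<close>

text \<open>The m-fold zeroth face from degree \<open>n\<close> to degree \<open>n - m\<close>. The
  degree \<open>n - m\<close> of the face is written \<open>Suc (n - Suc m)\<close> so that the
  rules for faces in successor degrees apply.\<close>

primrec d0_iter :: "('o, 'm, 'z) fp_cat_scheme \<Rightarrow> ('o, 'm) sgrp \<Rightarrow> nat \<Rightarrow> nat \<Rightarrow> 'm" where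
  "d0_iter C G n 0 = Idt C (car G n)"
| "d0_iter C G n (Suc m) = gface G (Suc (n - Suc m)) 0 \<cdot>\<^bsub>C\<^esub> d0_iter C G n m"

definition Wgr_unit :: "('o, 'm, 'z) fp_cat_scheme \<Rightarrow> ('o, 'm) sgrp \<Rightarrow> nat \<Rightarrow> 'm" where
  "Wgr_unit C G n = W_tuple C (car G n) n (\<lambda>k. d0_iter C G n (n - k))"

definition Wgr_mult :: "('o, 'm, 'z) fp_cat_scheme \<Rightarrow> ('o, 'm) sgrp \<Rightarrow> nat \<Rightarrow> 'm" where
  "Wgr_mult C G n = W_tuple C (W_space C (Wgr_obj C G) n) n
    (\<lambda>k. W_el C G k k \<cdot>\<^bsub>C\<^esub> W_el C (Wgr_obj C G) n k)"

definition Wgr_\<eta> :: "('o, 'm, 'z) fp_cat_scheme \<Rightarrow> ('o, 'm) sgrp \<Rightarrow> ('o, 'm) sgrp_arr" where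
  "Wgr_\<eta> C G = HArr G (Wgr_obj C G) (\<lambda>n. HArr (splx G n) (Wgr_group C G n) (Wgr_unit C G n))"

definition Wgr_\<mu> :: "('o, 'm, 'z) fp_cat_scheme \<Rightarrow> ('o, 'm) sgrp \<Rightarrow> ('o, 'm) sgrp_arr" where
  "Wgr_\<mu> C G = HArr (Wgr_obj C (Wgr_obj C G)) (Wgr_obj C G)
    (\<lambda>n. HArr (Wgr_group C (Wgr_obj C G) n) (Wgr_group C G n) (Wgr_mult C G n))"

lemma hmap_Wgr_\<eta>_\<mu>:
  "hmap (hmap (Wgr_\<eta> C G) n) = Wgr_unit C G n"
  "hmap (hmap (Wgr_\<mu> C G) n) = Wgr_mult C G n"
  by (simp_all add: Wgr_\<eta>_def Wgr_\<mu>_def)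

context finite_product_category
begin

context
  fixes G :: "('o, 'm) sgrp"
  assumes G [simp]: "simplicial_object (Grp C) G"
begin

section \<open>The unit\<close>

lemma d0_iter_arr:
  assumes "m \<le> n"
  shows "d0_iter C G n m \<in> Arr C \<and> Dom C (d0_iter C G n m) = car G n \<and>
    Cod C (d0_iter C G n m) = car G (n - m)"
  using assms
proof (induction m)
  case (Suc m)
  then obtain k where "n = Suc (m + k)" by (auto dest: le_Suc_ex)
  then show ?case using Suc by simp
qed simp

lemma Wgr_unit_arr [simp]:
  "Wgr_unit C G n \<in> Arr C" "Dom C (Wgr_unit C G n) = car G n"
  "Cod C (Wgr_unit C G n) = W_space C G n" "W_el C G n n \<cdot> Wgr_unit C G n = Idt C (car G n)"
  using W_tuple_arr[OF G, of "car G n" n "\<lambda>k. d0_iter C G n (n - k)"] d0_iter_arr[of "n - _" n]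
  by (simp_all add: Wgr_unit_def)

lemma W_el_unit:
  assumes k: "k < n"
  shows "W_el C G n k \<cdot> Wgr_unit C G n = gface G (Suc k) 0 \<cdot> (W_el C G n (Suc k) \<cdot> Wgr_unit C G n)"
proof -
  have el: "W_el C G n j \<cdot> Wgr_unit C G n = d0_iter C G n (n - j)" if "j \<le> n" for j
    using W_tuple_arr(4)[OF G, of "car G n" n "\<lambda>k. d0_iter C G n (n - k)" j]
      d0_iter_arr[of "n - _" n] that
    by (simp add: Wgr_unit_def)
  have "n - k = Suc (n - Suc k)" using k by simp
  then show ?thesis using k by (simp add: el)
qed

lemma W_el_unit_comp [simp]:
  assumes "h \<in> Arr C" "Cod C h = car G n"
  shows "W_el C G n n \<cdot> (Wgr_unit C G n \<cdot> h) = h"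
proof -
  have "W_el C G n n \<cdot> (Wgr_unit C G n \<cdot> h) = (W_el C G n n \<cdot> Wgr_unit C G n) \<cdot> h"
    using assms by (simp del: Wgr_unit_arr(4))
  then show ?thesis using assms by simp
qed

lemma W_el_unit_comp_less:
  assumes k: "k < n" and h: "h \<in> Arr C" "Cod C h = car G n"
  shows "W_el C G n k \<cdot> (Wgr_unit C G n \<cdot> h) =
    gface G (Suc k) 0 \<cdot> (W_el C G n (Suc k) \<cdot> (Wgr_unit C G n \<cdot> h))"
  using arg_cong[OF W_el_unit[OF k], of "\<lambda>f. f \<cdot> h"] k h by simp

text \<open>The counterpart of \<open>theta_unique\<close> with all lower factors trivial: the
  relation h_k = d_0 h_(k+1) leaves only the top entry free.\<close>

lemma Wgr_unit_unique:
  assumes f: "f \<in> Arr C" "Cod C f = W_space C G n"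
    and h: "h \<in> Arr C" "Cod C h = car G n" "Dom C h = Dom C f"
    and top: "W_el C G n n \<cdot> f = h"
    and step: "\<And>k. k < n \<Longrightarrow> W_el C G n k \<cdot> f = gface G (Suc k) 0 \<cdot> (W_el C G n (Suc k) \<cdot> f)"
  shows "f = Wgr_unit C G n \<cdot> h"
proof (rule W_eqI[OF G, of _ _ n])
  fix k assume "k \<le> n"
  then show "W_el C G n k \<cdot> f = W_el C G n k \<cdot> (Wgr_unit C G n \<cdot> h)"
  proof (induction k rule: inc_induct)
    case base
    show ?case using h top by simp
  next
    case (step k)
    then show ?case using assms(7)[of k] h by (simp add: W_el_unit_comp_less[of k])
  qed
qed (use f h in simp_all)

text \<open>Each entry is a composite of zeroth faces, starting from the identity at the top, and
  all of these are homomorphisms.\<close>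

lemma Wgr_unit_hom: "group_hom C (splx G n) (Wgr_group C G n) (Wgr_unit C G n)"
proof (rule Wgr_group_homI[OF G])
  fix k assume "k \<le> n"
  then show "group_hom C (splx G n) (splx G k) (W_el C G n k \<cdot> Wgr_unit C G n)"
  proof (induction k rule: inc_induct)
    case base
    show ?case by (simp add: group_hom_idt)
  next
    case (step k)
    then show ?case
      by (auto simp: W_el_unit[of k] intro!: group_hom_comp[of _ "splx G (Suc k)"] gface_hom)
  qed
qed simp_all

text \<open>The argument is that for \<open>theta\<close> with the factors g_k removed. In the
  middle case the relation reads h_k = d_0 d_0 h_(k+2) = d_0 d_1 h_(k+2).\<close>

lemma Wgr_unit_face:
  assumes i: "i \<le> Suc n"
  shows "Wgr_unit C G n \<cdot> gface G (Suc n) i = Wgr_face C G (Suc n) i \<cdot> Wgr_unit C G (Suc n)"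
proof (rule Wgr_unit_unique[symmetric])
  show "W_el C G n n \<cdot> (Wgr_face C G (Suc n) i \<cdot> Wgr_unit C G (Suc n)) = gface G (Suc n) i"
    using i by (cases i) (auto simp: W_el_unit[of n "Suc n"])
  fix k assume k: "k < n"
  consider "n < i + k" | "n = i + k" | "i + k < n" by linarith
  then show "W_el C G n k \<cdot> (Wgr_face C G (Suc n) i \<cdot> Wgr_unit C G (Suc n)) =
      gface G (Suc k) 0 \<cdot> (W_el C G n (Suc k) \<cdot> (Wgr_face C G (Suc n) i \<cdot> Wgr_unit C G (Suc n)))"
  proof cases
    case 1
    then show ?thesis using i k
      by (simp add: W_el_unit[of "Suc k" "Suc n"] gface_gface[of G 0 "Suc (i + k - n)"] Suc_diff_le)
  next
    case 2
    then show ?thesis using i k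
      by (simp add: W_el_unit[of k "Suc (i + k)"] W_el_unit[of "Suc k" "Suc (i + k)"]
          gface_gface[of G 0 "Suc 0"])
  next
    case 3
    then show ?thesis using i k by (simp add: W_el_unit[of k "Suc n"])
  qed
qed (use i in simp_all)

lemma Wgr_unit_degen:
  assumes i: "i \<le> n"
  shows "Wgr_unit C G (Suc n) \<cdot> gdegen G n i = Wgr_degen C G n i \<cdot> Wgr_unit C G n"
proof (rule Wgr_unit_unique[symmetric])
  fix k assume k: "k < Suc n"
  consider "n < i + k" | "n = i + k" | "i + k < n" by linarith
  then show "W_el C G (Suc n) k \<cdot> (Wgr_degen C G n i \<cdot> Wgr_unit C G n) =
      gface G (Suc k) 0 \<cdot> (W_el C G (Suc n) (Suc k) \<cdot> (Wgr_degen C G n i \<cdot> Wgr_unit C G n))"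
  proof cases
    case 1
    then obtain l where l: "k = Suc l" using i by (cases k) auto
    show ?thesis using 1 i k
      by (simp add: l W_el_unit[of l n] gface_gdegen_less[of G 0 "Suc (i + l - n)"] Suc_diff_le)
  next
    case 2
    then show ?thesis using i k by (simp add: gface_gdegen_cancel)
  next
    case 3
    then show ?thesis using i k by (simp add: W_el_unit[of k n])
  qed
qed (use i in simp_all)

section \<open>The multiplication\<close>

lemma Wgr_mult_arr [simp]:
  "Wgr_mult C G n \<in> Arr C" "Dom C (Wgr_mult C G n) = W_space C (Wgr_obj C G) n"
  "Cod C (Wgr_mult C G n) = W_space C G n"
  "k \<le> n \<Longrightarrow> W_el C G n k \<cdot> Wgr_mult C G n = W_el C G k k \<cdot> W_el C (Wgr_obj C G) n k"
  unfolding Wgr_mult_def by (rule W_tuple_arr[OF G]; simp)+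

lemma W_el_mult_comp [simp]:
  assumes "k \<le> n" "h \<in> Arr C" "Cod C h = W_space C (Wgr_obj C G) n"
  shows "W_el C G n k \<cdot> (Wgr_mult C G n \<cdot> h) = W_el C G k k \<cdot> (W_el C (Wgr_obj C G) n k \<cdot> h)"
  using arg_cong[OF Wgr_mult_arr(4)[OF assms(1)], of "\<lambda>f. f \<cdot> h"] assms
  by (simp del: Wgr_mult_arr(4))

lemma Wgr_mult_hom:
  "group_hom C (Wgr_group C (Wgr_obj C G) n) (Wgr_group C G n) (Wgr_mult C G n)"
proof (rule Wgr_group_homI[OF G])
  fix k assume k: "k \<le> n"
  have "group_hom C (Wgr_group C (Wgr_obj C G) n) (Wgr_group C G k) (W_el C (Wgr_obj C G) n k)"
    using W_el_hom[of "Wgr_obj C G" k n] k by simp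
  then show "group_hom C (Wgr_group C (Wgr_obj C G) n) (splx G k) (W_el C G n k \<cdot> Wgr_mult C G n)"
    using k by (auto intro!: group_hom_comp[of _ "Wgr_group C G k"] W_el_hom)
qed simp_all

text \<open>A face of positive index \<open>j\<close> in Wgr acts on the leading entry by d_j,
  whereas d_0 would discard that entry. Only positive indices arise inside the inner simplices,
  since a face is applied there exactly when \<open>n < i + k\<close>, with index
  \<open>i + k - n\<close>.\<close>

lemma Wgr_mult_face:
  assumes i: "i \<le> Suc n"
  shows "Wgr_mult C G n \<cdot> Wgr_face C (Wgr_obj C G) (Suc n) i =
    Wgr_face C G (Suc n) i \<cdot> Wgr_mult C G (Suc n)"
proof (rule W_eqI[OF G, of _ _ n])
  fix k assume "k \<le> n"
  then show "W_el C G n k \<cdot> (Wgr_mult C G n \<cdot> Wgr_face C (Wgr_obj C G) (Suc n) i) =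
      W_el C G n k \<cdot> (Wgr_face C G (Suc n) i \<cdot> Wgr_mult C G (Suc n))"
    using i by auto
qed (use i in simp_all)

text \<open>Every degeneracy s_j of Wgr acts on the leading entry by s_j, including the case
  \<open>j = 0\<close>, so taking leading entries is compatible with all of them.\<close>

lemma Wgr_mult_degen:
  assumes i: "i \<le> n"
  shows "Wgr_mult C G (Suc n) \<cdot> Wgr_degen C (Wgr_obj C G) n i =
    Wgr_degen C G n i \<cdot> Wgr_mult C G n"
proof (rule W_eqI[OF G, of _ _ "Suc n"])
  fix k assume "k \<le> Suc n"
  then show "W_el C G (Suc n) k \<cdot> (Wgr_mult C G (Suc n) \<cdot> Wgr_degen C (Wgr_obj C G) n i) =
      W_el C G (Suc n) k \<cdot> (Wgr_degen C G n i \<cdot> Wgr_mult C G n)"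
    using i by (cases k) auto
qed (use i in simp_all)

lemma Wgr_\<eta>_hom: "Wgr_\<eta> C G \<in> hom (sGrp C) G (Wgr_obj C G)"
  using sGrp_homI[of G "Wgr_obj C G" "Wgr_unit C G"]
  by (simp add: Wgr_\<eta>_def Wgr_unit_hom Wgr_unit_face Wgr_unit_degen)

lemma Wgr_\<mu>_hom: "Wgr_\<mu> C G \<in> hom (sGrp C) (Wgr_obj C (Wgr_obj C G)) (Wgr_obj C G)"
  using sGrp_homI[of "Wgr_obj C (Wgr_obj C G)" "Wgr_obj C G" "Wgr_mult C G"]
  by (simp add: Wgr_\<mu>_def Wgr_mult_hom Wgr_mult_face Wgr_mult_degen)

end

section \<open>The monad laws and naturality\<close>

context
  fixes G :: "('o, 'm) sgrp"
  assumes G [simp]: "simplicial_object (Grp C) G"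
begin

text \<open>Either side sends entry \<open>k\<close> of a simplex of the threefold construction to
  the leading entry of its leading entry.\<close>

lemma Wgr_mult_assoc:
  "Wgr_mult C G n \<cdot> W_map C (Wgr_\<mu> C G) n = Wgr_mult C G n \<cdot> Wgr_mult C (Wgr_obj C G) n"
proof -
  note [simp] = W_map_arr[OF Wgr_\<mu>_hom[OF G]] hmap_Wgr_\<eta>_\<mu>
  show ?thesis by (rule W_eqI[OF G, of _ _ n]) simp_all
qed

text \<open>In Wgr the face d_0 removes the leading entry, so iterating it on (x_n, ..., x_0) yields
  (x_k, ..., x_0) in degree \<open>k\<close>, whose leading entry is x_k.\<close>

lemma Wgr_mult_unit_left:
  "Wgr_mult C G n \<cdot> Wgr_unit C (Wgr_obj C G) n = Idt C (W_space C G n)"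
proof (rule W_eqI[OF G, of _ _ n])
  fix k assume "k \<le> n"
  \<comment> \<open>All entries \<open>j\<close>, not only the leading one, must enter the
    induction: the leading entry after one more d_0 is the second entry of the preceding
    tuple.\<close>
  then have "\<forall>j \<le> k. W_el C G k j \<cdot> (W_el C (Wgr_obj C G) n k \<cdot> Wgr_unit C (Wgr_obj C G) n) =
      W_el C G n j"
  proof (induction k rule: inc_induct)
    case base
    show ?case using Wgr_unit_arr(4)[of "Wgr_obj C G" n] by simp
  next
    case (step k)
    then show ?case by (auto simp: W_el_unit[of "Wgr_obj C G" k n])
  qed
  then show "W_el C G n k \<cdot> (Wgr_mult C G n \<cdot> Wgr_unit C (Wgr_obj C G) n) =
      W_el C G n k \<cdot> Idt C (W_space C G n)"
    using \<open>k \<le> n\<close> by simp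
qed simp_all

text \<open>The induced map replaces each x_k by its unit simplex, whose leading entry is x_k
  again.\<close>

lemma Wgr_mult_unit_right:
  "Wgr_mult C G n \<cdot> W_map C (Wgr_\<eta> C G) n = Idt C (W_space C G n)"
proof -
  note [simp] = W_map_arr[OF Wgr_\<eta>_hom[OF G]] hmap_Wgr_\<eta>_\<mu>
  show ?thesis by (rule W_eqI[OF G, of _ _ n]) simp_all
qed

end

text \<open>\<open>F\<close> commutes with d_0, so the right side satisfies the recursion for the
  unit of \<open>H\<close>, with top entry given by \<open>F\<close>.\<close>

lemma Wgr_unit_natural:
  assumes F: "F \<in> hom (sGrp C) G H"
  shows "Wgr_unit C H n \<cdot> hmap (hmap F n) = W_map C F n \<cdot> Wgr_unit C G n"
proof -
  note [simp] = sGrp_hom_objs[OF F] hmap_hmap_arr[OF F] hmap_gface[OF F] W_map_arr[OF F]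
    W_el_W_map_comp[OF F]
  show ?thesis
    by (rule Wgr_unit_unique[symmetric]) (simp_all add: W_el_unit[of G _ n])
qed

lemma Wgr_mult_natural:
  assumes F: "F \<in> hom (sGrp C) G H"
  shows "Wgr_mult C H n \<cdot> W_map C (farr (Wgr_functor C) F) n = W_map C F n \<cdot> Wgr_mult C G n"
proof -
  have h: "hmap (hmap (farr (Wgr_functor C) F) n) = W_map C F n" for n
    by (simp add: Wgr_functor_def)
  note [simp] = sGrp_hom_objs[OF F] hmap_hmap_arr[OF F] W_map_arr[OF F] W_el_W_map_comp[OF F]
    W_map_arr[OF Wgr_functor_hom[OF F]] h
  show ?thesis by (rule W_eqI[of H _ _ n]) simp_all
qed

lemma fobj_Wgr: "fobj (Wgr_functor C) G = Wgr_obj C G"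
  by (simp add: Wgr_functor_def)

lemma Wgr_monad: "cat_monad (sGrp C) (Wgr_functor C) (Wgr_\<eta> C) (Wgr_\<mu> C)"
proof -
  interpret S: category "sGrp C" by (rule category_sGrp)
  interpret T: cat_functor "sGrp C" "sGrp C" "Wgr_functor C" by (rule cat_functor_Wgr)
  note h = Wgr_\<eta>_hom Wgr_\<mu>_hom Wgr_functor_hom
  have hmap_Wgr: "hmap (hmap (farr (Wgr_functor C) F) n) = W_map C F n" for F n
    by (simp add: Wgr_functor_def)
  note hm = hmap_Wgr hmap_Wgr_\<eta>_\<mu>
  show ?thesis
  proof (intro cat_monad.intro natural_transformation.intro natural_transformation_axioms.intro
      cat_monad_axioms.intro)
    show "cat_functor (sGrp C) (sGrp C) (ftr_id :: (_, _, ('o, 'm) sgrp, _) ftr)"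
      by (rule cat_functor_id[OF category_sGrp])
    show "cat_functor (sGrp C) (sGrp C) (ftr_comp (Wgr_functor C) (Wgr_functor C))"
      by (rule cat_functor_comp[OF cat_functor_Wgr cat_functor_Wgr])
    fix G H F
    {
      assume "G \<in> Obj (sGrp C)"
      then have G: "simplicial_object (Grp C) G" by simp
      then have WG: "simplicial_object (Grp C) (Wgr_obj C G)" by simp
      show "Wgr_\<eta> C G \<in> hom (sGrp C) (fobj ftr_id G) (fobj (Wgr_functor C) G)"
        using h(1)[OF G] by (simp add: ftr_id_def fobj_Wgr)
      show "Wgr_\<mu> C G \<in> hom (sGrp C) (fobj (ftr_comp (Wgr_functor C) (Wgr_functor C)) G)
          (fobj (Wgr_functor C) G)"
        using h(2)[OF G] by (simp add: ftr_comp_def fobj_Wgr)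
      show "Wgr_\<mu> C G \<cdot>\<^bsub>sGrp C\<^esub> farr (Wgr_functor C) (Wgr_\<mu> C G) =
          Wgr_\<mu> C G \<cdot>\<^bsub>sGrp C\<^esub> Wgr_\<mu> C (fobj (Wgr_functor C) G)"
        unfolding fobj_Wgr
        by (rule sGrp_arr_eqI[OF S.Comp_hom[OF h(3)[OF h(2)[OF G]] h(2)[OF G]]
              S.Comp_hom[OF h(2)[OF WG] h(2)[OF G]]])
          (simp add: hm Wgr_mult_assoc[OF G])
      show "Wgr_\<mu> C G \<cdot>\<^bsub>sGrp C\<^esub> Wgr_\<eta> C (fobj (Wgr_functor C) G) =
          Idt (sGrp C) (fobj (Wgr_functor C) G)"
        unfolding fobj_Wgr
        by (rule sGrp_arr_eqI[OF S.Comp_hom[OF h(1)[OF WG] h(2)[OF G]] S.Idt_hom])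
          (use WG in \<open>simp_all add: hm Wgr_mult_unit_left[OF G]\<close>)
      show "Wgr_\<mu> C G \<cdot>\<^bsub>sGrp C\<^esub> farr (Wgr_functor C) (Wgr_\<eta> C G) =
          Idt (sGrp C) (fobj (Wgr_functor C) G)"
        unfolding fobj_Wgr
        by (rule sGrp_arr_eqI[OF S.Comp_hom[OF h(3)[OF h(1)[OF G]] h(2)[OF G]] S.Idt_hom])
          (use WG in \<open>simp_all add: hm Wgr_mult_unit_right[OF G]\<close>)
    }
    {
      assume F: "F \<in> hom (sGrp C) G H"
      note G = sGrp_hom_objs(1)[OF F] and H = sGrp_hom_objs(2)[OF F]
      show "Wgr_\<eta> C H \<cdot>\<^bsub>sGrp C\<^esub> farr ftr_id F = farr (Wgr_functor C) F \<cdot>\<^bsub>sGrp C\<^esub> Wgr_\<eta> C G"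
        unfolding ftr_id_def ftr.simps
        by (rule sGrp_arr_eqI[OF S.Comp_hom[OF F h(1)[OF H]] S.Comp_hom[OF h(1)[OF G] h(3)[OF F]]])
          (simp add: hm Wgr_unit_natural[OF F])
      show "Wgr_\<mu> C H \<cdot>\<^bsub>sGrp C\<^esub> farr (ftr_comp (Wgr_functor C) (Wgr_functor C)) F =
          farr (Wgr_functor C) F \<cdot>\<^bsub>sGrp C\<^esub> Wgr_\<mu> C G"
        unfolding ftr_comp_def ftr.simps
        by (rule sGrp_arr_eqI[OF S.Comp_hom[OF h(3)[OF h(3)[OF F]] h(2)[OF H]]
              S.Comp_hom[OF h(2)[OF G] h(3)[OF F]]])
          (simp add: hm Wgr_mult_natural[OF F])
    }
  qed (rule cat_functor_Wgr)+
qed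

end

theorem mainTheorem1:
  fixes C :: "('o, 'm) fp_cat"
  assumes "finite_product_category C"
  shows "naturally_isomorphic (sGrp C) (Simp C)
           (W_functor C) (ftr_comp forget_sGrp (Wgr_functor C)) \<and>
         (\<exists>\<eta> \<mu>. cat_monad (sGrp C) (Wgr_functor C) \<eta> \<mu>)"
  using finite_product_category.W_iso_forget_Wgr[OF assms]
    finite_product_category.Wgr_monad[OF assms] by blast

end
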